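(* Let $n\ge 1$ and $s\ge 1$ be fixed integers. As $H\to\infty$, $$\#\mathcal{K}_{n,s}(H)\le H^{sn^2-n+o(1)}.$$
   Context: $\mathcal{M}_n(\mathbb{Z};H)$ is the set of $n\times n$ matrices with integer entries of absolute value at most $H$. $\mathcal{K}_{n,s}(H)$ is the set of $s$-tuples $(A_1,\dots,A_s)\in\mathcal{M}_n(\mathbb{Z};H)^s$ of non-singular matrices for which there is a relation $$A_{i_1}^{\pm1}\cdots A_{i_L}^{\pm1}=I_n,\qquad i_1,\dots,i_L\in\{1,\dots,s\},\ L\ge1,$$ (a word in $A_1^{\pm1},\dots,A_s^{\pm1}$ equal to the identity) such that for at least one $i\in\{1,\dots,s\}$ the $\pm1$ exponents of $A_i$ occurring in the word do not sum to zero. Equivalently, the kernel of the abelianisation map $G\to G/[G,G]$ of the group $G$ generated by $A_1,\dots,A_s$ contains (the value of) a word in which, for some $i$, the exponents of $A_i$ do not sum to zero. Here $o(1)$ is a quantity tending to $0$ as $H\to\infty$ with $n,s$ fixed. *)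

theory Defs
  imports Complex_Main "HOL-Algebra.Multiplicative_Group" "Jordan_Normal_Form.Determinant"
begin

definition bounded_int_mats :: "nat \<Rightarrow> real \<Rightarrow> int mat set" where
  "bounded_int_mats n H =
     {A \<in> carrier_mat n n. \<forall>i<n. \<forall>j<n. \<bar>real_of_int (A $$ (i, j))\<bar> \<le> H}"

(* Inverses of integer matrices need not be integral, so words are evaluated
   in the general linear group over the rationals. *)
definition GL_rat :: "nat \<Rightarrow> rat mat monoid" where
  "GL_rat n = units_of (ring_mat TYPE(rat) n ())"

(* A letter (i, e) stands for the e-th power of the i-th matrix, with indices running
   from 0 to s - 1. *)
definition is_word :: "nat \<Rightarrow> (nat \<times> int) list \<Rightarrow> bool" where
  "is_word s w \<longleftrightarrow> w \<noteq> [] \<and> (\<forall>(i, e) \<in> set w. i < s \<and> (e = 1 \<or> e = -1))"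

definition word_value :: "nat \<Rightarrow> int mat list \<Rightarrow> (nat \<times> int) list \<Rightarrow> rat mat" where
  "word_value n As w =
     foldr (\<lambda>(i, e) P. (map_mat of_int (As ! i) [^]\<^bsub>GL_rat n\<^esub> e) \<otimes>\<^bsub>GL_rat n\<^esub> P) w \<one>\<^bsub>GL_rat n\<^esub>"

definition exponent_sum :: "nat \<Rightarrow> (nat \<times> int) list \<Rightarrow> int" where
  "exponent_sum i w = (\<Sum>(j, e) \<leftarrow> w. if j = i then e else 0)"

definition K_tuples :: "nat \<Rightarrow> nat \<Rightarrow> real \<Rightarrow> int mat list set" where
  "K_tuples n s H =
     {As. length As = s \<and> set As \<subseteq> bounded_int_mats n H \<and> (\<forall>A \<in> set As. det A \<noteq> 0) \<and>
          (\<exists>w. is_word s w \<and> word_value n As w = \<one>\<^bsub>GL_rat n\<^esub> \<and>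
               (\<exists>i<s. exponent_sum i w \<noteq> 0))}"

(* The cardinality of K_tuples n s H is a genuine count, card being 0 on infinite sets. *)
lemma finite_bounded_int_mats: "finite (bounded_int_mats n H)"
proof -
  let ?I = "{..<n} \<times> {..<n}" and ?B = "{- \<lfloor>H\<rfloor>..\<lfloor>H\<rfloor>}"
  have "bounded_int_mats n H \<subseteq> mat n n ` (?I \<rightarrow>\<^sub>E ?B)"
  proof
    fix A assume A: "A \<in> bounded_int_mats n H"
    let ?f = "restrict (\<lambda>p. A $$ p) ?I"
    have "A $$ (i, j) \<in> ?B" if "i < n" "j < n" for i j
    proof -
      have "of_int \<bar>A $$ (i, j)\<bar> \<le> H"
        using A that by (auto simp: bounded_int_mats_def)
      then have "\<bar>A $$ (i, j)\<bar> \<le> \<lfloor>H\<rfloor>" by (simp only: le_floor_iff)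
      then show ?thesis by (auto simp: abs_le_iff)
    qed
    then have "?f \<in> ?I \<rightarrow>\<^sub>E ?B" by (intro restrict_PiE_iff[THEN iffD2]) blast
    moreover have "A = mat n n ?f"
      using A by (intro eq_matI) (auto simp: bounded_int_mats_def)
    ultimately show "A \<in> mat n n ` (?I \<rightarrow>\<^sub>E ?B)" by blast
  qed
  then show ?thesis
    by (rule finite_subset) (intro finite_imageI finite_PiE; simp)
qed

lemma finite_K_tuples: "finite (K_tuples n s H)"
proof (rule finite_subset)
  show "K_tuples n s H \<subseteq> {As. set As \<subseteq> bounded_int_mats n H \<and> length As = s}"
    by (auto simp: K_tuples_def)
qed (rule finite_lists_length_eq[OF finite_bounded_int_mats])

end

(* Taking determinants in the relation gives a multiplicative dependence among the integers
   det A_i in which some exponent is nonzero, say that of A_j, so every prime dividing det A_j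
   divides the determinant of another A_i. Given the other matrices, Rankin's trick leaves
   H^o(1) possible values for det A_j, and it remains to bound, uniformly in d nonzero, the number
   of matrices of determinant d by H^(n^2 - n + o(1)).

   For this, classify a matrix with rows a_1, ..., a_n by the flag of the spaces
   W_k = <a_1, ..., a_k>. If b is one fixed matrix of determinant d with this flag, each
   a_k is determined modulo W_(k-1) by the determinant of b with its k-th row replaced by a_k; this
   is an integer dividing a bounded power of d, so it takes H^o(1) values. A flag therefore carries at
   most H^o(1) times the product over k < n of the number of integer points of W_k in a box of
   size 2H. Finally, a space W spanned by k vectors of the box contains, up to a constant factor
   and a dilation of the box, as many independent k-tuples as k-tuples; since such a tuple determines
   W, the sum over W of the k-th power of the number of its box points is at most a constant times the k-th
   power of the number of points of the ambient space. Applying this along the flag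
   gives the bound H^(n(n-1)). *)
theory Submission
  imports Defs "HOL-Library.Function_Algebras"
begin

subsection \<open>Counting flags of spaces spanned by box vectors\<close>

text \<open>The index of a box stands for its size: sums and differences add indices, which is the
  source of every dilation below. A vector space over an arbitrary field of characteristic 0 is
  enough for the counting.\<close>

locale vector_space_boxes = vector_space scale
  for scale :: "'a::field_char_0 \<Rightarrow> 'b::ab_group_add \<Rightarrow> 'b" (infixr "*s" 75) +
  fixes B :: "nat \<Rightarrow> 'b set"
  assumes finite_box: "finite (B t)"
    and zero_in_box: "0 \<in> B t"
    and box_add: "x \<in> B t \<Longrightarrow> y \<in> B u \<Longrightarrow> x + y \<in> B (t + u)"
    and box_diff: "x \<in> B t \<Longrightarrow> y \<in> B u \<Longrightarrow> x - y \<in> B (t + u)"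
begin

fun indep_list :: "'b list \<Rightarrow> bool" where
  "indep_list [] \<longleftrightarrow> True"
| "indep_list (x # xs) \<longleftrightarrow> x \<notin> span (set xs) \<and> indep_list xs"

text \<open>The spaces are the spans of the suffixes, from the whole list down to the zero space.
  Consing a vector thus adds a new top space, and rows are added from the last one upwards.\<close>

fun flag :: "'b list \<Rightarrow> 'b set list" where
  "flag [] = [span {}]"
| "flag (x # xs) = span (set (x # xs)) # flag xs"

definition indep_tuples :: "nat \<Rightarrow> 'b set \<Rightarrow> 'b list set" where
  "indep_tuples k S = {xs. length xs = k \<and> indep_list xs \<and> set xs \<subseteq> S}"

lemma indep_list_independent: "indep_list xs \<Longrightarrow> independent (set xs) \<and> distinct xs"
  by (induction xs) (auto simp: independent_insert independent_empty intro: span_base)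

lemma indep_list_length_le:
  assumes "indep_list xs" "set xs \<subseteq> span (set ys)"
  shows "length xs \<le> length ys"
proof -
  have "card (set xs) \<le> card (set ys)"
    using independent_span_bound[of "set ys" "set xs"] assms indep_list_independent by auto
  then show ?thesis
    using indep_list_independent[OF assms(1)] card_length[of ys] by (simp add: distinct_card)
qed

text \<open>A vector of \<open>ys\<close> outside the span of \<open>xs\<close> could be put in
  front of \<open>xs\<close>, giving an independent list inside the span of \<open>ys\<close> that
  is longer than \<open>ys\<close>.\<close>

lemma indep_list_span_eq:
  assumes "indep_list xs" "set xs \<subseteq> span (set ys)" "length ys \<le> length xs"
  shows "span (set xs) = span (set ys)"
proof -
  have "set ys \<subseteq> span (set xs)"
  proof (rule subsetI, rule ccontr)
    fix y assume "y \<in> set ys" "y \<notin> span (set xs)"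
    then have "length (y # xs) \<le> length ys"
      using assms by (intro indep_list_length_le) (auto intro: span_base)
    then show False using assms by simp
  qed
  then show ?thesis using assms span_eq by blast
qed

lemma length_flag: "length (flag xs) = Suc (length xs)"
  by (induction xs) auto

lemma hd_flag: "hd (flag xs) = span (set xs)"
  by (cases xs) auto

lemma finite_indep_tuples: "finite S \<Longrightarrow> finite (indep_tuples k S)"
  by (rule finite_subset[OF _ finite_lists_length_eq[of S k]]) (auto simp: indep_tuples_def)

lemma box_mono: "t \<le> u \<Longrightarrow> B t \<subseteq> B u"
  using box_add[OF _ zero_in_box, of _ t "u - t"] by auto

text \<open>Translating by a box vector of \<open>V\<close> outside the span of a partial tuple moves every vector of
  that span off it, so at least half of the vectors extend the tuple.\<close>

lemma card_pow_le_indep_tuples: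
  assumes ys: "ys \<in> indep_tuples k (B h)" and "j \<le> k"
  shows "card (B t \<inter> span (set ys)) ^ j
    \<le> 2 ^ j * card (indep_tuples j (B (t + h) \<inter> span (set ys)))"
  using \<open>j \<le> k\<close>
proof (induction j)
  case 0
  have "indep_tuples 0 (B (t + h) \<inter> span (set ys)) = {[]}"
    by (auto simp: indep_tuples_def)
  then show ?case by simp
next
  case (Suc j)
  let ?V = "span (set ys)"
  let ?S = "B (t + h) \<inter> ?V"
  let ?c = "card (B t \<inter> ?V)"
  have fin: "finite ?S" by (simp add: finite_box)
  have half: "?c \<le> 2 * card (?S - span (set xs))" if xs: "xs \<in> indep_tuples j ?S" for xs
  proof -
    let ?U = "span (set xs)"
    have "\<not> set ys \<subseteq> ?U"
    proof
      assume "set ys \<subseteq> ?U"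
      then have "length ys \<le> length xs"
        using ys by (intro indep_list_length_le) (auto simp: indep_tuples_def)
      then show False using ys xs Suc.prems by (simp add: indep_tuples_def)
    qed
    then obtain y where y: "y \<in> set ys" "y \<notin> ?U" by blast
    then have yB: "y \<in> B h" "y \<in> ?V" using ys by (auto simp: indep_tuples_def span_base)
    have "card (B t \<inter> ?V \<inter> ?U) \<le> card (?S - ?U)"
    proof (rule card_inj_on_le[where f = "\<lambda>x. x + y"])
      show "(\<lambda>x. x + y) ` (B t \<inter> ?V \<inter> ?U) \<subseteq> ?S - ?U"
        using yB y box_add by (auto intro: span_add simp: span_add_eq)
    qed (use fin in auto)
    moreover have "card (B t \<inter> ?V - ?U) \<le> card (?S - ?U)"
      using box_mono[of t "t + h"] by (intro card_mono) (auto simp: finite_box)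
    moreover have "?c = card (B t \<inter> ?V \<inter> ?U) + card (B t \<inter> ?V - ?U)"
      by (subst card_Un_disjoint[symmetric]) (auto simp: finite_box intro: arg_cong[where f = card])
    ultimately show ?thesis by linarith
  qed
  let ?E = "Sigma (indep_tuples j ?S) (\<lambda>xs. ?S - span (set xs))"
  have "?c ^ Suc j \<le> 2 ^ j * (\<Sum>xs\<in>indep_tuples j ?S. ?c)"
    using Suc by (simp add: mult.commute)
  also have "\<dots> \<le> 2 ^ j * (\<Sum>xs\<in>indep_tuples j ?S. 2 * card (?S - span (set xs)))"
    using half by (intro mult_left_mono sum_mono) auto
  also have "\<dots> = 2 ^ Suc j * card ?E"
    using fin by (subst card_SigmaI) (auto simp: finite_indep_tuples sum_distrib_left mult_ac)
  also have "card ?E \<le> card (indep_tuples (Suc j) ?S)"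
  proof (rule card_inj_on_le[where f = "\<lambda>(xs, x). x # xs"])
    show "(\<lambda>(xs, x). x # xs) ` ?E \<subseteq> indep_tuples (Suc j) ?S"
      by (auto simp: indep_tuples_def)
  qed (auto simp: inj_on_def fin finite_indep_tuples)
  finally show ?case by simp
qed

definition box_spans :: "nat \<Rightarrow> nat \<Rightarrow> 'b set set" where
  "box_spans k h = (\<lambda>xs. span (set xs)) ` indep_tuples k (B h)"

lemma finite_box_spans: "finite (box_spans k h)"
  by (simp add: box_spans_def finite_indep_tuples finite_box)

text \<open>The k-th power for \<open>W\<close> is at most \<open>2 ^ k\<close> times the number of
  independent k-tuples of points of \<open>W\<close>. Such a tuple spans \<open>W\<close>, so tuples
  from different spaces are different, and all of them are k-tuples of points of
  \<open>V\<close>.\<close>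

lemma sum_box_spans_card_pow_le:
  "(\<Sum>W | W \<in> box_spans k h \<and> W \<subseteq> V. card (B t \<inter> W) ^ k) \<le> 2 ^ k * card (B (t + h) \<inter> V) ^ k"
proof -
  let ?I = "{W. W \<in> box_spans k h \<and> W \<subseteq> V}"
  let ?T = "\<lambda>W. indep_tuples k (B (t + h) \<inter> W)"
  have span_T: "span (set xs) = W" if W: "W \<in> ?I" and xs: "xs \<in> ?T W" for W xs
  proof -
    obtain ys where ys: "ys \<in> indep_tuples k (B h)" "W = span (set ys)"
      using W by (auto simp: box_spans_def)
    then show ?thesis
      using xs indep_list_span_eq[of xs ys] by (simp add: indep_tuples_def)
  qed
  have fin: "finite ?I" using finite_box_spans by simp
  have disj: "\<forall>W\<in>?I. \<forall>W'\<in>?I. W \<noteq> W' \<longrightarrow> ?T W \<inter> ?T W' = {}"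
  proof (intro ballI impI equals0I)
    fix W W' xs assume "W \<in> ?I" "W' \<in> ?I" "W \<noteq> W'" "xs \<in> ?T W \<inter> ?T W'"
    then show False using span_T[of W xs] span_T[of W' xs] by simp
  qed
  have "(\<Sum>W\<in>?I. card (B t \<inter> W) ^ k) \<le> (\<Sum>W\<in>?I. 2 ^ k * card (?T W))"
    using card_pow_le_indep_tuples[of _ k h k t] by (intro sum_mono) (auto simp: box_spans_def)
  also have "\<dots> = 2 ^ k * card (\<Union>W\<in>?I. ?T W)"
    unfolding sum_distrib_left[symmetric] using disj fin
    by (subst card_UN_disjoint) (simp_all add: finite_indep_tuples finite_box)
  also have "card (\<Union>W\<in>?I. ?T W)
      \<le> card {xs. set xs \<subseteq> B (t + h) \<inter> V \<and> length xs = k}"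
    by (intro card_mono finite_lists_length_eq) (auto simp: indep_tuples_def finite_box)
  also have "\<dots> = card (B (t + h) \<inter> V) ^ k"
    by (rule card_lists_length_eq) (simp add: finite_box)
  finally show ?thesis by simp
qed

definition flags :: "nat \<Rightarrow> nat \<Rightarrow> 'b set \<Rightarrow> 'b set list set" where
  "flags k h V = {flag xs | xs. xs \<in> indep_tuples k (B h) \<and> span (set xs) = V}"

definition flag_weight :: "nat \<Rightarrow> 'b set list \<Rightarrow> nat" where
  "flag_weight t F = (\<Prod>W\<leftarrow>F. card (B t \<inter> W))"

lemma finite_flags: "finite (flags k h V)"
proof -
  have "flags k h V \<subseteq> flag ` indep_tuples k (B h)" by (auto simp: flags_def)
  then show ?thesis by (rule finite_subset) (simp add: finite_indep_tuples finite_box)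
qed

text \<open>Removing the top space \<open>V\<close> leaves a flag of some \<open>W\<close> inside
  \<open>V\<close>. The induction hypothesis bounds the weights over \<open>W\<close> by the k-th
  power of a point count of \<open>W\<close>, exactly the power that can be summed over all
  \<open>W\<close>. Each step enlarges the box by \<open>h\<close>, whence
  \<open>(k + 2) * h\<close>.\<close>

lemma sum_flag_weight_le:
  assumes "u \<le> 2 * h"
  shows "(\<Sum>F\<in>flags k h V. flag_weight u F) \<le> 2 ^ (k * k) * card (B ((k + 2) * h) \<inter> V) ^ k"
proof (induction k arbitrary: V)
  case 0
  have "flags 0 h V \<subseteq> {[{0}]}" by (auto simp: flags_def indep_tuples_def)
  then have "(\<Sum>F\<in>flags 0 h V. flag_weight u F) \<le> (\<Sum>F\<in>{[{0}]}. flag_weight u F)"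
    by (intro sum_mono2) auto
  also have "\<dots> \<le> 1" using card_mono[of "{0}" "B u \<inter> {0}"] by (simp add: flag_weight_def)
  finally show ?case by simp
next
  case (Suc k)
  let ?I = "{W. W \<in> box_spans k h \<and> W \<subseteq> V}"
  let ?t = "(k + 2) * h"
  let ?c = "card (B (?t + h) \<inter> V)"
  have sub: "flags (Suc k) h V \<subseteq> (\<lambda>(W, F). V # F) ` Sigma ?I (\<lambda>W. flags k h W)"
  proof
    fix F assume "F \<in> flags (Suc k) h V"
    then obtain x xs where F: "F = flag (x # xs)" "x # xs \<in> indep_tuples (Suc k) (B h)"
      "V = span (set (x # xs))"
      by (auto simp: flags_def indep_tuples_def length_Suc_conv)
    then have "xs \<in> indep_tuples k (B h)" by (auto simp: indep_tuples_def)
    moreover have "span (set xs) \<subseteq> V" unfolding F by (intro span_mono) auto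
    ultimately show "F \<in> (\<lambda>(W, F). V # F) ` Sigma ?I (\<lambda>W. flags k h W)"
      using F by (intro image_eqI[of _ _ "(span (set xs), flag xs)"])
        (auto simp: box_spans_def flags_def)
  qed
  have "(\<Sum>F\<in>flags (Suc k) h V. flag_weight u F)
    \<le> (\<Sum>F\<in>(\<lambda>(W, F). V # F) ` Sigma ?I (\<lambda>W. flags k h W). flag_weight u F)"
    using sub by (intro sum_mono2) (auto simp: finite_flags finite_box_spans)
  also have "\<dots> \<le> (\<Sum>(W, F)\<in>Sigma ?I (\<lambda>W. flags k h W). flag_weight u (V # F))"
    by (rule order_trans[OF sum_image_le])
      (auto simp: finite_flags finite_box_spans case_prod_beta o_def)
  also have "\<dots> = (\<Sum>W\<in>?I. \<Sum>F\<in>flags k h W. flag_weight u (V # F))"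
    by (subst sum.Sigma) (auto simp: finite_flags finite_box_spans)
  also have "\<dots> = card (B u \<inter> V) * (\<Sum>W\<in>?I. \<Sum>F\<in>flags k h W. flag_weight u F)"
    by (simp add: flag_weight_def sum_distrib_left)
  \<comment> \<open>The box of size \<open>u\<close> around the top space is enlarged as well, so
    that its count becomes the missing factor of the power \<open>Suc k\<close>.\<close>
  also have "\<dots> \<le> ?c * (\<Sum>W\<in>?I. 2 ^ (k * k) * card (B ?t \<inter> W) ^ k)"
    using Suc.IH box_mono[of u "?t + h"] assms
    by (intro mult_mono sum_mono card_mono) (auto simp: finite_box algebra_simps)
  also have "\<dots> = ?c * (2 ^ (k * k) * (\<Sum>W\<in>?I. card (B ?t \<inter> W) ^ k))"
    by (simp add: sum_distrib_left)
  also have "\<dots> \<le> ?c * (2 ^ (k * k) * (2 ^ k * ?c ^ k))"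
    by (intro mult_left_mono sum_box_spans_card_pow_le) auto
  also have "\<dots> = 2 ^ (k * k + k) * ?c ^ Suc k" by (simp add: power_add)
  also have "\<dots> \<le> 2 ^ (Suc k * Suc k) * ?c ^ Suc k"
    by (intro mult_right_mono power_increasing) auto
  finally show ?case by (simp add: algebra_simps)
qed

end


section \<open>Level sets of an alternating form that is integral on boxes\<close>

locale boxed_alternating_form = vector_space_boxes +
  fixes n :: nat and D :: "'b list \<Rightarrow> 'a"
  assumes box_dim: "\<exists>es. length es = n \<and> (\<forall>t. B t \<subseteq> span (set es))"
    and form_add: "length us + length vs + 1 = n \<Longrightarrow>
      D (us @ (x + y) # vs) = D (us @ x # vs) + D (us @ y # vs)"
    and form_scale: "length us + length vs + 1 = n \<Longrightarrow> D (us @ (c *s x) # vs) = c * D (us @ x # vs)"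
    and form_repeat: "length us + length vs + 1 = n \<Longrightarrow> x \<in> set vs \<Longrightarrow> D (us @ x # vs) = 0"
    and form_integral: "length xs = n \<Longrightarrow> set xs \<subseteq> B t \<Longrightarrow> D xs \<in> \<int>"
begin

text \<open>Expanding \<open>x\<close> over \<open>vs\<close> by linearity, every term repeats a
  vector. Repetitions to the right of the slot are the relevant ones, since flags consist of spans
  of suffixes.\<close>

lemma form_span_eq_0:
  assumes "x \<in> span (set vs)" and n: "length us + length vs + 1 = n"
  shows "D (us @ x # vs) = 0"
  using assms(1)
proof (induction rule: span_induct_alt)
  case base
  then show ?case using form_scale[OF n, of 0 0] by simp
next
  case (step c x y)
  then show ?case by (simp add: form_add[OF n] form_scale[OF n] form_repeat[OF n])
qed

text \<open>Only the class of a row modulo the span of the later rows matters to the form. Within a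
  flag that class is a multiple of the class of the reference row.\<close>

lemma form_cong_span:
  assumes "x - c *s y \<in> span (set vs)" and n: "length us + length vs + 1 = n"
  shows "D (us @ x # vs) = c * D (us @ y # vs)"
  using form_add[OF n, of "x - c *s y" "c *s y"] assms by (simp add: form_span_eq_0 form_scale)

lemma form_nonzero_indep:
  assumes "D (us @ xs) \<noteq> 0" "length us + length xs = n"
  shows "indep_list xs"
  using assms
proof (induction xs arbitrary: us)
  case (Cons x xs)
  then show ?case using form_span_eq_0[of x xs us] Cons.IH[of "us @ [x]"] by auto
qed simp

text \<open>The fixed first rows \<open>us\<close> allow an induction that replaces the rows of the reference matrix one at a
  time. Each step multiplies the determinant \<open>d\<close> by \<open>D0\<close> and passes to a divisor, so that all values
  met on the way divide \<open>M\<close>.\<close>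

lemma card_form_flag_le:
  fixes M :: int
  assumes "M \<noteq> 0" "length us + length bs = n" "set us \<subseteq> B h" "set bs \<subseteq> B h"
    and "D (us @ bs) = of_int D0" "D0 \<noteq> 0" "d \<noteq> 0" "D0 ^ length bs * d dvd M"
  shows "card {as. flag as = flag bs \<and> set as \<subseteq> B h \<and> D (us @ as) = of_int d}
      * card (B (2 * h) \<inter> span (set bs))
    \<le> card {v. v dvd M} ^ length bs * flag_weight (2 * h) (flag bs)"
  using assms(2-)
proof (induction bs arbitrary: us d)
  case Nil
  have "as = []" if "flag as = flag []" for as
    using arg_cong[OF that, of length] by (simp add: length_flag del: flag.simps)
  then have "card {as. flag as = flag [] \<and> set as \<subseteq> B h \<and> D (us @ as) = of_int d} \<le> card {[] :: 'b list}"
    by (intro card_mono) (auto simp del: flag.simps)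
  then show ?case by (simp add: flag_weight_def)
next
  case (Cons y bs)
  let ?V = "span (set (y # bs))" and ?f = "\<lambda>x. D (us @ x # bs)"
  let ?S = "\<lambda>us bs d. {as. flag as = flag bs \<and> set as \<subseteq> B h \<and> D (us @ as) = of_int d}"
  let ?T = "{v. v dvd D0 * d}"
  let ?X = "\<lambda>v. {x \<in> B h \<inter> ?V. ?f x = of_int v}"
  let ?k = "length bs" and ?w = "\<lambda>W. card (B (2 * h) \<inter> W)"
  have len: "length us + length bs + 1 = n" using Cons.prems by simp
  have E0: "D0 * d \<noteq> 0" using Cons.prems by simp
  have dvdM: "D0 ^ Suc ?k * d dvd M" using Cons.prems by simp
  have finS: "finite (?S us' bs' d')" for us' bs' d'
  proof (rule finite_subset[OF subsetI finite_lists_length_eq[OF finite_box, of h "length bs'"]])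
    fix as assume "as \<in> ?S us' bs' d'"
    then have "length (flag as) = length (flag bs')" "set as \<subseteq> B h" by simp_all
    then show "as \<in> {xs. set xs \<subseteq> B h \<and> length xs = length bs'}" by (simp add: length_flag)
  qed
  have finX: "finite (?X v)" for v by (simp add: finite_box)
  \<comment> \<open>Two vectors of a fibre differ by a vector of \<open>?V\<close> on which
    \<open>?f\<close> vanishes. Its component along \<open>y\<close> is zero because
    \<open>?f y\<close> is \<open>D0\<close>, which is nonzero, so the difference lies in the span
    of \<open>bs\<close>.\<close>
  have fibre: "card (?X v) \<le> ?w (span (set bs))" for v
  proof (cases "?X v = {}")
    case False
    then obtain x0 where x0: "x0 \<in> ?X v" by blast
    show ?thesis
    proof (rule card_inj_on_le[where f = "\<lambda>x. x - x0"])
      show "(\<lambda>x. x - x0) ` ?X v \<subseteq> B (2 * h) \<inter> span (set bs)"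
      proof
        fix z assume "z \<in> (\<lambda>x. x - x0) ` ?X v"
        then obtain x where x: "x \<in> ?X v" "z = x - x0" by blast
        have zB: "z \<in> B (2 * h)" using x x0 box_diff[of x h x0 h] by (simp add: mult_2)
        have "z \<in> ?V" using x x0 by (auto intro: span_diff)
        then obtain c where c: "z - c *s y \<in> span (set bs)" by (auto simp: span_breakdown_eq)
        have "?f x = ?f z + ?f x0" using form_add[OF len, of z x0] x by simp
        then have "?f z = 0" using x x0 by simp
        then have "c = 0" using form_cong_span[OF c len] Cons.prems by simp
        then show "z \<in> B (2 * h) \<inter> span (set bs)" using c zB by simp
      qed
    qed (auto simp: inj_on_def finite_box)
  next
    case True
    then show ?thesis by (simp only: card.empty le0)
  qed
  \<comment> \<open>Write the first vector as \<open>x = c y\<close> modulo the span of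
    \<open>bs\<close>, which is also the span of \<open>as\<close>. Then
    \<open>?f x = c * D0\<close> and \<open>d = c * D (us @ y # as)\<close>, so the integers
    \<open>?f x\<close> and \<open>D (us @ y # as)\<close> have product
    \<open>D0 * d\<close>.\<close>
  have sub: "?S us (y # bs) d
    \<subseteq> (\<lambda>(x, as). x # as) ` (\<Union>v\<in>?T. ?X v \<times> ?S (us @ [y]) bs (D0 * d div v))"
  proof
    fix xs assume xs: "xs \<in> ?S us (y # bs) d"
    then have "length (flag xs) = length (flag (y # bs))" by simp
    then obtain x as where xs_eq: "xs = x # as"
      by (cases xs) (simp_all add: length_flag del: flag.simps)
    have fl: "flag as = flag bs" and V: "span (set (x # as)) = ?V"
      using xs by (auto simp: xs_eq)
    have W: "span (set as) = span (set bs)" using fl hd_flag by metis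
    have las: "length us + length as + 1 = n" using arg_cong[OF fl, of length] len
      by (simp add: length_flag)
    have xV: "x \<in> ?V" using V by (auto intro: span_base)
    then obtain c where c: "x - c *s y \<in> span (set bs)" by (auto simp: span_breakdown_eq)
    have fx: "?f x = c * of_int D0" using form_cong_span[OF c len] Cons.prems by simp
    have dx: "of_int d = c * D (us @ y # as)"
      using form_cong_span[of x c y as us] c las xs W by (simp add: xs_eq)
    have "?f x \<in> \<int>" using xs Cons.prems by (intro form_integral[of _ h]) (auto simp: xs_eq)
    then obtain v where v: "?f x = of_int v" by (auto elim: Ints_cases)
    have "D (us @ y # as) \<in> \<int>"
      using xs Cons.prems las by (intro form_integral[of _ h]) (auto simp: xs_eq)
    then obtain d' where d': "D (us @ y # as) = of_int d'" by (auto elim: Ints_cases)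
    have "of_int (v * d') = (of_int (D0 * d) :: 'a)"
      using fx dx v d' by (simp add: mult_ac)
    then have vd: "v * d' = D0 * d" by (simp only: of_int_eq_iff)
    then have "v dvd D0 * d" "d' = D0 * d div v" using E0 by (metis dvd_triv_left, auto simp flip: vd)
    then show "xs \<in> (\<lambda>(x, as). x # as) ` (\<Union>v\<in>?T. ?X v \<times> ?S (us @ [y]) bs (D0 * d div v))"
      using xs xV fl v d' by (intro image_eqI[of _ _ "(x, as)"]) (auto simp: xs_eq)
  qed
  \<comment> \<open>Moving \<open>y\<close> into the fixed rows keeps the reference value
    \<open>D0\<close> and leaves the cofactor of \<open>v\<close> in \<open>D0 * d\<close> as the
    new value. The count on the left is the fibre bound, so the product bounds the pairs belonging
    to \<open>v\<close>.\<close>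
  have IH: "card (?S (us @ [y]) bs (D0 * d div v)) * ?w (span (set bs))
      \<le> card {v. v dvd M} ^ ?k * flag_weight (2 * h) (flag bs)" if v: "v \<in> ?T" for v
  proof (rule Cons.IH)
    obtain q where q: "D0 * d = v * q" using v by (auto elim: dvdE)
    then have dq: "D0 * d div v = q" and q0: "q \<noteq> 0" using E0 by auto
    show "D0 * d div v \<noteq> 0" using q0 dq by simp
    have "D0 ^ ?k * q dvd D0 ^ ?k * (D0 * d)" unfolding q by simp
    also have "D0 ^ ?k * (D0 * d) = D0 ^ Suc ?k * d" by simp
    finally show "D0 ^ ?k * (D0 * d div v) dvd M" using dvdM dq by (metis dvd_trans)
  qed (use Cons.prems in auto)
  have "card (?S us (y # bs) d) \<le> card (\<Union>v\<in>?T. ?X v \<times> ?S (us @ [y]) bs (D0 * d div v))"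
    using E0 by (intro surj_card_le[OF _ sub] finite_UN_I finite_divisors_int
        finite_cartesian_product finX finS)
  also have "\<dots> \<le> (\<Sum>v\<in>?T. card (?X v \<times> ?S (us @ [y]) bs (D0 * d div v)))"
    by (rule card_UN_le[OF finite_divisors_int[OF E0]])
  also have "\<dots> \<le> (\<Sum>v\<in>?T. card {v. v dvd M} ^ ?k * flag_weight (2 * h) (flag bs))"
  proof (rule sum_mono)
    fix v assume v: "v \<in> ?T"
    have "card (?X v \<times> ?S (us @ [y]) bs (D0 * d div v))
      \<le> card (?S (us @ [y]) bs (D0 * d div v)) * ?w (span (set bs))"
      using fibre[of v] by (simp add: card_cartesian_product mult.commute)
    then show "card (?X v \<times> ?S (us @ [y]) bs (D0 * d div v))
      \<le> card {v. v dvd M} ^ ?k * flag_weight (2 * h) (flag bs)"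
      using IH[OF v] by (rule order_trans)
  qed
  also have "\<dots> \<le> card {v. v dvd M} * (card {v. v dvd M} ^ ?k * flag_weight (2 * h) (flag bs))"
  proof -
    have "D0 * d dvd M" using dvdM by (auto simp: mult_ac intro: dvd_trans[rotated])
    then have "card ?T \<le> card {v. v dvd M}"
      using finite_divisors_int[OF assms(1)] by (intro card_mono) (auto intro: dvd_trans)
    then show ?thesis by simp
  qed
  \<comment> \<open>The rows contribute only the proper subspaces of the flag; multiplying by the
    count for \<open>?V\<close> completes the weight.\<close>
  finally have "card (?S us (y # bs) d) * ?w ?V
    \<le> card {v. v dvd M} * (card {v. v dvd M} ^ ?k * flag_weight (2 * h) (flag bs)) * ?w ?V"
    by (rule mult_right_mono) simp
  then show ?case by (simp add: flag_weight_def mult_ac)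
qed

text \<open>All tuples have the full space as the top of their flag. Each flag takes one of its own
  tuples as reference, so \<open>D0\<close> is \<open>d\<close> and \<open>d ^ (n + 1)\<close> can
  serve as \<open>M\<close>. The factor \<open>card (B (2 * h))\<close> is the weight of the top
  space; dividing by it is what later saves a factor of order h^n.\<close>

lemma card_form_level_set_le:
  fixes d :: int
  assumes d: "d \<noteq> 0"
  shows "card {as. length as = n \<and> set as \<subseteq> B h \<and> D as = of_int d} * card (B (2 * h))
    \<le> card {v. v dvd d ^ (n + 1)} ^ n * (2 ^ (n * n) * card (B ((n + 2) * h)) ^ n)"
proof -
  let ?A = "{as. length as = n \<and> set as \<subseteq> B h \<and> D as = of_int d}"
  let ?T = "card {v. v dvd d ^ (n + 1)} ^ n"
  obtain es where es: "length es = n" "\<And>t. B t \<subseteq> span (set es)" using box_dim by blast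
  let ?V = "span (set es)"
  have finA: "finite ?A"
    by (rule finite_subset[OF _ finite_lists_length_eq[OF finite_box, of h n]]) auto
  have A: "as \<in> indep_tuples n (B h) \<and> span (set as) = ?V" if "as \<in> ?A" for as
  proof -
    have "indep_list as" using that d form_nonzero_indep[of "[]" as] by simp
    then show ?thesis using that es indep_list_span_eq[of as es] by (auto simp: indep_tuples_def)
  qed
  have BV: "B t \<inter> ?V = B t" for t using es by blast
  have each: "card {as \<in> ?A. flag as = F} * card (B (2 * h)) \<le> ?T * flag_weight (2 * h) F"
    if F: "F \<in> flag ` ?A" for F
  proof -
    obtain bs where bs: "bs \<in> ?A" "F = flag bs" using F by blast
    have eq: "{as \<in> ?A. flag as = F} = {as. flag as = flag bs \<and> set as \<subseteq> B h \<and> D ([] @ as) = of_int d}"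
      using bs length_flag by auto (metis length_flag old.nat.inject)
    show ?thesis
      using card_form_flag_le[of "d ^ (n + 1)" "[]" bs h d d] bs d A[OF bs(1)]
      unfolding eq by (simp add: BV mult.commute)
  qed
  have "?A = (\<Union>F\<in>flag ` ?A. {as \<in> ?A. flag as = F})" by blast
  then have "card ?A \<le> (\<Sum>F\<in>flag ` ?A. card {as \<in> ?A. flag as = F})"
    using card_UN_le[of "flag ` ?A" "\<lambda>F. {as \<in> ?A. flag as = F}"] finA by simp
  then have "card ?A * card (B (2 * h)) \<le> (\<Sum>F\<in>flag ` ?A. card {as \<in> ?A. flag as = F}) * card (B (2 * h))"
    by (rule mult_right_mono) simp
  also have "\<dots> = (\<Sum>F\<in>flag ` ?A. card {as \<in> ?A. flag as = F} * card (B (2 * h)))"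
    by (rule sum_distrib_right)
  also have "\<dots> \<le> (\<Sum>F\<in>flag ` ?A. ?T * flag_weight (2 * h) F)"
    using each by (rule sum_mono)
  also have "\<dots> \<le> (\<Sum>F\<in>flags n h ?V. ?T * flag_weight (2 * h) F)"
    using A by (intro sum_mono2 finite_flags) (auto simp: flags_def)
  also have "\<dots> \<le> ?T * (2 ^ (n * n) * card (B ((n + 2) * h) \<inter> ?V) ^ n)"
    unfolding sum_distrib_left[symmetric] by (intro mult_left_mono sum_flag_weight_le) auto
  finally show ?thesis by (simp add: BV)
qed

end

subsection \<open>Integers with prescribed prime divisors\<close>

text \<open>Rankin's bound, proved by recursion in place of an Euler product. A number either avoids
  \<open>p\<close> or is \<open>p\<close> times a number up to \<open>X div p\<close>. With
  \<open>u\<close> for p^(-e) and \<open>c\<close> for the product over the other primes, the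
  recursion closes because c + u c / (1 - u) = c / (1 - u).\<close>

lemma card_prime_support_le_prod:
  fixes e :: real
  assumes "e > 0" "finite P" "\<And>p. p \<in> P \<Longrightarrow> prime p"
  shows "real (card {y::nat. 0 < y \<and> y \<le> X \<and> prime_factors y \<subseteq> P})
    \<le> real X powr e * (\<Prod>p\<in>P. 1 / (1 - real p powr - e))"
  using assms(2,3)
proof (induction P arbitrary: X rule: finite_induct)
  case empty
  have "{y::nat. 0 < y \<and> y \<le> X \<and> prime_factors y \<subseteq> {}} \<subseteq> (if X = 0 then {} else {1})"
    by (auto simp: prime_factorization_empty_iff)
  from card_mono[OF _ this] have "card {y::nat. 0 < y \<and> y \<le> X \<and> prime_factors y \<subseteq> {}} \<le> (if X = 0 then 0 else 1)"
    by (auto split: if_splits)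
  moreover have "(if X = 0 then 0 else 1) \<le> real X powr e"
    using \<open>e > 0\<close> by (auto intro: ge_one_powr_ge_zero)
  ultimately show ?case by (auto split: if_splits)
next
  case (insert p P)
  define Y where "Y = (\<lambda>P X. {y::nat. 0 < y \<and> y \<le> X \<and> prime_factors y \<subseteq> P})"
  define c where "c = (\<Prod>p\<in>P. 1 / (1 - real p powr - e))"
  define u where "u = real p powr - e"
  have p: "prime p" using insert.prems by simp
  have u: "0 < u" "u < 1"
    using p prime_gt_1_nat[OF p] \<open>e > 0\<close> by (auto simp: u_def powr_less_one)
  have c: "c \<ge> 0"
    unfolding c_def
  proof (intro prod_nonneg)
    fix q assume "q \<in> P"
    then have "prime q" using insert.prems by simp
    then have "real q powr - e < 1" using prime_gt_1_nat[of q] \<open>e > 0\<close> by (intro powr_less_one) auto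
    then show "0 \<le> 1 / (1 - real q powr - e)" by simp
  qed
  have finY: "finite (Y P' X)" for P' X
    by (rule finite_subset[of _ "{..X}"]) (auto simp: Y_def)
  have "real (card (Y (insert p P) X)) \<le> real X powr e * (c / (1 - u))"
  proof (induction X rule: less_induct)
    case (less X)
    show ?case
    proof (cases "X = 0")
      case True
      then have "Y (insert p P) X = {}" by (auto simp: Y_def)
      then show ?thesis using u c by simp
    next
      case False
      have "Y (insert p P) X \<subseteq> Y P X \<union> (\<lambda>y. p * y) ` Y (insert p P) (X div p)"
      proof
        fix y assume y: "y \<in> Y (insert p P) X"
        show "y \<in> Y P X \<union> (\<lambda>y. p * y) ` Y (insert p P) (X div p)"
        proof (cases "p dvd y")
          case True
          then obtain z where z: "y = p * z" by (auto elim: dvdE)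
          have "z \<le> X div p"
            using y z prime_gt_0_nat[OF p] by (simp add: Y_def less_eq_div_iff_mult_less_eq mult.commute)
          moreover have "prime_factors z \<subseteq> prime_factors y"
            using y z by (intro dvd_prime_factors) (auto simp: Y_def)
          ultimately show ?thesis using y z by (auto simp: Y_def)
        next
          case False
          then show ?thesis using y by (auto simp: Y_def in_prime_factors_iff)
        qed
      qed
      then have "card (Y (insert p P) X) \<le> card (Y P X \<union> (\<lambda>y. p * y) ` Y (insert p P) (X div p))"
        by (intro card_mono) (simp_all add: finY)
      also have "\<dots> \<le> card (Y P X) + card ((\<lambda>y. p * y) ` Y (insert p P) (X div p))"
        by (rule card_Un_le)
      also have "\<dots> \<le> card (Y P X) + card (Y (insert p P) (X div p))"
        by (intro add_left_mono card_image_le finY)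
      finally have "real (card (Y (insert p P) X))
          \<le> real (card (Y P X)) + real (card (Y (insert p P) (X div p)))"
        by linarith
      also have "real (card (Y P X)) \<le> real X powr e * c"
        using insert.IH[of X] insert.prems by (simp add: Y_def c_def)
      also have "real (card (Y (insert p P) (X div p))) \<le> real (X div p) powr e * (c / (1 - u))"
        using False prime_gt_1_nat[OF p] by (intro less) simp
      also have "\<dots> \<le> (real X powr e * u) * (c / (1 - u))"
      proof -
        have "real (X div p) powr e \<le> (real X / real p) powr e"
        proof (intro powr_mono2)
          have "real (X div p) * real p \<le> real X"
            using div_times_less_eq_dividend[of X p] by (simp flip: of_nat_mult)
          then show "real (X div p) \<le> real X / real p"
            using prime_gt_0_nat[OF p] by (simp add: pos_le_divide_eq)
        qed (use \<open>e > 0\<close> in auto)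
        also have "\<dots> = real X powr e * u"
          by (simp add: u_def powr_divide powr_minus_divide)
        finally show ?thesis using u c by (intro mult_right_mono) auto
      qed
      also have "real X powr e * c + real X powr e * u * (c / (1 - u)) = real X powr e * (c / (1 - u))"
        using u by (simp add: field_simps)
      finally show ?thesis by simp
    qed
  qed
  then show ?case
    using insert.hyps by (simp add: Y_def c_def u_def)
qed

lemma prod_prime_factors_le: "(\<Prod>p\<in>prime_factors n. p) \<le> n" if "n > 0" for n :: nat
proof -
  have "(\<Prod>p\<in>prime_factors n. p) \<le> (\<Prod>p\<in>prime_factors n. p ^ multiplicity p n)"
  proof (rule prod_mono)
    fix p assume p: "p \<in> prime_factors n"
    then have "p ^ 1 \<le> p ^ multiplicity p n"
      by (intro power_increasing)
        (auto simp: prime_factors_multiplicity Suc_le_eq prime_gt_0_nat)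
    then show "0 \<le> p \<and> p \<le> p ^ multiplicity p n" by simp
  qed
  also have "\<dots> = n" using that by (rule prime_factorization_nat[symmetric])
  finally show ?thesis .
qed

text \<open>A factor is at most p^e once p^e >= 2, that is from \<open>N\<close> on. Each of the
  fewer than \<open>N\<close> smaller primes costs an extra constant \<open>K\<close>, the value of
  the factor at 2. The remaining product of the p^e is the e-th power of the radical of
  \<open>Q\<close>.\<close>

lemma prod_inverse_prime_powr_bound:
  fixes e :: real
  assumes e: "e > 0"
  shows "\<exists>K>0. \<forall>Q::nat. Q > 0 \<longrightarrow> (\<Prod>p\<in>prime_factors Q. 1 / (1 - real p powr - e)) \<le> K * real Q powr e"
proof -
  define K where "K = 1 / (1 - 2 powr - e)"
  define N where "N = nat \<lceil>2 powr (1 / e)\<rceil>"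
  have two: "2 powr - e < 1" using e by (intro powr_less_one) auto
  have K: "K \<ge> 1" using two by (simp add: K_def field_simps)
  have factor: "0 \<le> 1 / (1 - real p powr - e) \<and>
      1 / (1 - real p powr - e) \<le> (if p < N then K else 1) * real p powr e" if "prime p" for p :: nat
  proof -
    have p: "real p \<ge> 2" using prime_ge_2_nat[OF that] by simp
    have pe: "real p powr - e < 1" using p e by (intro powr_less_one) auto
    have "1 / (1 - real p powr - e) \<le> (if p < N then K else 1) * real p powr e"
    proof (cases "p < N")
      case True
      have "real p powr - e \<le> 2 powr - e" using p e by (intro powr_mono2') auto
      then have "1 / (1 - real p powr - e) \<le> K * 1"
        using two pe by (simp add: K_def frac_le)
      also have "\<dots> \<le> K * real p powr e"
        using K p e by (intro mult_left_mono ge_one_powr_ge_zero) auto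
      finally show ?thesis using True by simp
    next
      case False
      then have "2 powr (1 / e) \<le> real p" by (simp add: N_def) linarith
      then have "(2 powr (1 / e)) powr e \<le> real p powr e" using e by (intro powr_mono2) auto
      then have w: "real p powr e \<ge> 2" using e by (simp add: powr_powr)
      have "real p powr e * inverse (real p powr e) = 1"
        using w by (cases "p = 0") auto
      \<comment> \<open>For w = p^e >= 2 one has w (1 - 1/w) = w - 1 >= 1.\<close>
      then have "1 \<le> real p powr e * (1 - inverse (real p powr e))"
        using w by (simp only: right_diff_distrib)
      moreover have "inverse (real p powr e) \<le> inverse 2" using w by (intro le_imp_inverse_le) auto
      ultimately have "1 / (1 - inverse (real p powr e)) \<le> real p powr e"
        by (simp add: pos_divide_le_eq)
      then show ?thesis using False by (simp add: powr_minus)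
    qed
    then show ?thesis using pe by simp
  qed
  have "(\<Prod>p\<in>prime_factors Q. 1 / (1 - real p powr - e)) \<le> K ^ N * real Q powr e" if Q: "Q > 0" for Q :: nat
  proof -
    let ?P = "prime_factors Q"
    have "(\<Prod>p\<in>?P. 1 / (1 - real p powr - e)) \<le> (\<Prod>p\<in>?P. (if p < N then K else 1) * real p powr e)"
      by (intro prod_mono factor in_prime_factors_imp_prime)
    also have "\<dots> = (\<Prod>p\<in>?P. if p < N then K else 1) * (\<Prod>p\<in>?P. real p powr e)"
      by (rule prod.distrib)
    also have "\<dots> \<le> K ^ N * real Q powr e"
    proof (rule mult_mono)
      have "(\<Prod>p\<in>?P. if p < N then K else 1) = K ^ card {p \<in> ?P. p < N}"
        by (subst prod.If_cases) (auto simp: Int_def)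
      also have "\<dots> \<le> K ^ N"
        using K card_mono[of "{..<N}" "{p \<in> ?P. p < N}"] by (intro power_increasing) auto
      finally show "(\<Prod>p\<in>?P. if p < N then K else 1) \<le> K ^ N" .
      have "(\<Prod>p\<in>?P. real p powr e) = (\<Prod>p\<in>?P. real p) powr e"
        by (rule prod_powr_distrib[symmetric])
      also have "(\<Prod>p\<in>?P. real p) = real (\<Prod>p\<in>?P. p)" by simp
      also have "\<dots> powr e \<le> real Q powr e"
        using prod_prime_factors_le[OF Q] e by (intro powr_mono2) (auto simp del: of_nat_prod)
      finally show "(\<Prod>p\<in>?P. real p powr e) \<le> real Q powr e" .
    qed (use K in \<open>auto intro: prod_nonneg\<close>)
    finally show ?thesis .
  qed
  then show ?thesis using K by (intro exI[of _ "K ^ N"]) auto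
qed

text \<open>The two signs double the constant. The bound is uniform in \<open>X\<close> and
  \<open>Q\<close> and serves twice: for the divisors of a power of a determinant, and for the
  determinants allowed by the relation.\<close>

lemma card_prime_support_bound:
  fixes e :: real
  assumes e: "e > 0"
  shows "\<exists>K>0. \<forall>X Q::nat. Q > 0 \<longrightarrow>
    finite {d::int. d \<noteq> 0 \<and> nat \<bar>d\<bar> \<le> X \<and> prime_factors (nat \<bar>d\<bar>) \<subseteq> prime_factors Q} \<and>
    real (card {d::int. d \<noteq> 0 \<and> nat \<bar>d\<bar> \<le> X \<and> prime_factors (nat \<bar>d\<bar>) \<subseteq> prime_factors Q})
      \<le> K * (real X * real Q) powr e"
proof -
  obtain K where K: "K > 0" and KQ:
    "\<And>Q::nat. Q > 0 \<Longrightarrow> (\<Prod>p\<in>prime_factors Q. 1 / (1 - real p powr - e)) \<le> K * real Q powr e"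
    using prod_inverse_prime_powr_bound[OF e] by blast
  have "finite {d::int. d \<noteq> 0 \<and> nat \<bar>d\<bar> \<le> X \<and> prime_factors (nat \<bar>d\<bar>) \<subseteq> prime_factors Q} \<and>
    real (card {d::int. d \<noteq> 0 \<and> nat \<bar>d\<bar> \<le> X \<and> prime_factors (nat \<bar>d\<bar>) \<subseteq> prime_factors Q})
      \<le> 2 * K * (real X * real Q) powr e" (is "finite ?S \<and> _") if Q: "Q > 0" for X Q :: nat
  proof -
    let ?Y = "{y::nat. 0 < y \<and> y \<le> X \<and> prime_factors y \<subseteq> prime_factors Q}"
    have finY: "finite ?Y" by (rule finite_subset[of _ "{..X}"]) auto
    have sub: "?S \<subseteq> int ` ?Y \<union> (\<lambda>y. - int y) ` ?Y"
    proof
      fix d assume d: "d \<in> ?S"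
      then have "nat \<bar>d\<bar> \<in> ?Y" by auto
      moreover have "d = int (nat \<bar>d\<bar>) \<or> d = - int (nat \<bar>d\<bar>)" by auto
      ultimately show "d \<in> int ` ?Y \<union> (\<lambda>y. - int y) ` ?Y" by blast
    qed
    have finU: "finite (int ` ?Y \<union> (\<lambda>y. - int y) ` ?Y)" using finY by simp
    with sub have fin: "finite ?S" by (rule finite_subset)
    have "card ?S \<le> card (int ` ?Y \<union> (\<lambda>y. - int y) ` ?Y)"
      using finU sub by (rule card_mono)
    also have "\<dots> \<le> card (int ` ?Y) + card ((\<lambda>y. - int y) ` ?Y)" by (rule card_Un_le)
    also have "\<dots> \<le> card ?Y + card ?Y" by (intro add_mono card_image_le finY)
    finally have "real (card ?S) \<le> 2 * real (card ?Y)" by simp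
    also have "\<dots> \<le> 2 * (real X powr e * (K * real Q powr e))"
      using card_prime_support_le_prod[OF e, of "prime_factors Q" X] KQ[OF Q]
      by (intro mult_left_mono order_trans[OF _ mult_left_mono[OF KQ[OF Q]]]) auto
    also have "\<dots> = 2 * K * (real X * real Q) powr e"
      by (simp add: powr_mult)
    finally show ?thesis using fin by blast
  qed
  then show ?thesis using K by (intro exI[of _ "2 * K"]) auto
qed

subsection \<open>Integer matrices of given determinant\<close>

definition fun_scale :: "rat \<Rightarrow> (nat \<Rightarrow> rat) \<Rightarrow> nat \<Rightarrow> rat" where
  "fun_scale c x = (\<lambda>i. c * x i)"

text \<open>Vectors are functions vanishing from \<open>n\<close> on, so that a single type carries
  the boxes of every dimension. Rational values provide the field that spans require.\<close>

definition int_box :: "nat \<Rightarrow> nat \<Rightarrow> (nat \<Rightarrow> rat) set" where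
  "int_box n t = {x. (\<forall>i. x i \<in> \<int>) \<and> (\<forall>i. \<bar>x i\<bar> \<le> of_nat t) \<and> (\<forall>i\<ge>n. x i = 0)}"

definition row_mat :: "nat \<Rightarrow> (nat \<Rightarrow> 'a) list \<Rightarrow> 'a mat" where
  "row_mat n xs = mat n n (\<lambda>(i, j). (xs ! i) j)"

lemma bij_betw_int_box:
  "bij_betw (\<lambda>f i. if i < n then rat_of_int (f i) else 0) ({..<n} \<rightarrow>\<^sub>E {- int t..int t}) (int_box n t)"
proof (rule bij_betw_imageI)
  show "inj_on (\<lambda>f i. if i < n then rat_of_int (f i) else 0) ({..<n} \<rightarrow>\<^sub>E {- int t..int t})"
  proof (rule inj_onI, rule PiE_ext)
    fix f g :: "nat \<Rightarrow> int" and i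
    assume eq: "(\<lambda>i. if i < n then rat_of_int (f i) else 0) = (\<lambda>i. if i < n then rat_of_int (g i) else 0)"
      and "i \<in> {..<n}"
    then show "f i = g i" using fun_cong[OF eq, of i] by simp
  qed
next
  have "(\<lambda>i. if i < n then rat_of_int (f i) else 0) \<in> int_box n t"
    if f: "f \<in> {..<n} \<rightarrow>\<^sub>E {- int t..int t}" for f
  proof -
    have "\<bar>of_int (f i)\<bar> \<le> (of_nat t :: rat)" if "i < n" for i
    proof -
      have "f i \<in> {- int t..int t}" using PiE_mem[OF f, of i] that by simp
      then have "\<bar>f i\<bar> \<le> int t" by auto
      then have "of_int \<bar>f i\<bar> \<le> (of_int (int t) :: rat)" by (simp only: of_int_le_iff)
      then show ?thesis by simp
    qed
    then show ?thesis by (auto simp: int_box_def)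
  qed
  moreover have "\<exists>f\<in>{..<n} \<rightarrow>\<^sub>E {- int t..int t}. x = (\<lambda>i. if i < n then rat_of_int (f i) else 0)"
    if x: "x \<in> int_box n t" for x
  proof -
    let ?f = "\<lambda>i\<in>{..<n}. \<lfloor>x i\<rfloor>"
    have fl: "of_int \<lfloor>x i\<rfloor> = x i" for i using x by (simp add: int_box_def)
    have "?f \<in> {..<n} \<rightarrow>\<^sub>E {- int t..int t}"
    proof (intro restrict_PiE_iff[THEN iffD2] ballI)
      fix i
      have "\<bar>x i\<bar> \<le> of_nat t" using x by (simp add: int_box_def)
      then have "of_int \<bar>\<lfloor>x i\<rfloor>\<bar> \<le> (of_int (int t) :: rat)" by (simp add: fl)
      then have "\<bar>\<lfloor>x i\<rfloor>\<bar> \<le> int t" by (simp only: of_int_le_iff)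
      then show "\<lfloor>x i\<rfloor> \<in> {- int t..int t}" by (simp add: abs_le_iff)
    qed
    moreover have "x = (\<lambda>i. if i < n then of_int (?f i) else 0)"
      using x by (auto simp: fl int_box_def)
    ultimately show ?thesis by blast
  qed
  ultimately show "(\<lambda>f i. if i < n then rat_of_int (f i) else 0) ` ({..<n} \<rightarrow>\<^sub>E {- int t..int t}) = int_box n t"
    unfolding set_eq_iff image_iff by blast
qed

lemma card_int_box: "card (int_box n t) = (2 * t + 1) ^ n"
  using bij_betw_same_card[OF bij_betw_int_box, of n t] by (simp add: card_PiE nat_add_distrib nat_mult_distrib)

text \<open>The cofactors along a row do not see that row, so they are taken with zero in its place.
  The right side is then visibly linear in \<open>x\<close>.\<close>

lemma det_row_mat_expand:
  fixes x :: "nat \<Rightarrow> 'a :: comm_ring_1"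
  assumes "length us + length vs + 1 = n"
  shows "det (row_mat n (us @ x # vs))
    = (\<Sum>j<n. x j * cofactor (row_mat n (us @ (\<lambda>_. 0) # vs)) (length us) j)"
proof -
  let ?A = "\<lambda>x. row_mat n (us @ x # vs)"
  have "cofactor (?A x) (length us) j = cofactor (?A (\<lambda>_. 0)) (length us) j" for j
  proof -
    have "mat_delete (?A x) (length us) j = mat_delete (?A (\<lambda>_. 0)) (length us) j"
      by (intro eq_matI) (auto simp: mat_delete_def row_mat_def nth_append nth_Cons split: nat.splits)
    then show ?thesis by (simp add: cofactor_def)
  qed
  moreover have "det (?A x) = (\<Sum>j<n. ?A x $$ (length us, j) * cofactor (?A x) (length us) j)"
    using assms by (intro laplace_expansion_row) (auto simp: row_mat_def)
  ultimately show ?thesis using assms by (simp add: row_mat_def)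
qed

global_interpretation int_rows: boxed_alternating_form fun_scale "int_box n" n "\<lambda>xs. det (row_mat n xs)" for n
proof -
  interpret vector_space fun_scale
    by unfold_locales (auto simp: fun_scale_def fun_eq_iff algebra_simps)
  show "boxed_alternating_form fun_scale (int_box n) n (\<lambda>xs. det (row_mat n xs))"
  proof (unfold_locales)
    show "finite (int_box n t)" for t
      using bij_betw_finite[OF bij_betw_int_box[of n t]] by (simp add: finite_PiE)
    show "0 \<in> int_box n t" for t by (simp add: int_box_def)
    show "x + y \<in> int_box n (t + u)" if "x \<in> int_box n t" "y \<in> int_box n u" for x y t u
      using that by (auto simp: int_box_def intro!: order_trans[OF abs_triangle_ineq] add_mono)
    show "x - y \<in> int_box n (t + u)" if "x \<in> int_box n t" "y \<in> int_box n u" for x y t u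
      using that by (auto simp: int_box_def intro!: order_trans[OF abs_triangle_ineq4] add_mono)
    let ?e = "\<lambda>i j. if i = j then 1 else 0 :: rat"
    have "int_box n t \<subseteq> span (set (map ?e [0..<n]))" for t
    proof
      fix x assume x: "x \<in> int_box n t"
      have sum_apply: "(\<Sum>i\<in>I. f i) j = (\<Sum>i\<in>I. f i j)" for f :: "nat \<Rightarrow> nat \<Rightarrow> rat" and I j
        by (induction I rule: infinite_finite_induct) auto
      have "x = (\<Sum>i<n. fun_scale (x i) (?e i))"
      proof
        fix j
        have "(\<Sum>i<n. x i * ?e i j) = (\<Sum>i<n. if i = j then x i else 0)"
          by (intro sum.cong) auto
        also have "\<dots> = x j" using x by (auto simp: int_box_def)
        finally show "x j = (\<Sum>i<n. fun_scale (x i) (?e i)) j" by (simp add: sum_apply fun_scale_def)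
      qed
      moreover have "(\<Sum>i<n. fun_scale (x i) (?e i)) \<in> span (set (map ?e [0..<n]))"
        by (intro span_sum span_scale span_base) auto
      ultimately show "x \<in> span (set (map ?e [0..<n]))" by simp
    qed
    then show "\<exists>es. length es = n \<and> (\<forall>t. int_box n t \<subseteq> span (set es))"
      by (intro exI[of _ "map ?e [0..<n]"]) simp
  next
    fix us vs :: "(nat \<Rightarrow> rat) list" and x y :: "nat \<Rightarrow> rat" and c :: rat
    assume len: "length us + length vs + 1 = n"
    show "det (row_mat n (us @ (x + y) # vs)) = det (row_mat n (us @ x # vs)) + det (row_mat n (us @ y # vs))"
      by (simp add: det_row_mat_expand[OF len] sum.distrib distrib_right)
    show "det (row_mat n (us @ fun_scale c x # vs)) = c * det (row_mat n (us @ x # vs))"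
      by (simp add: det_row_mat_expand[OF len] fun_scale_def sum_distrib_left mult.assoc)
    assume "x \<in> set vs"
    then obtain k where k: "k < length vs" "vs ! k = x" by (auto simp: in_set_conv_nth)
    show "det (row_mat n (us @ x # vs)) = 0"
      by (rule det_identical_rows[of _ n "length us" "length us + Suc k"])
        (use k len in \<open>auto simp: row_mat_def nth_append intro!: eq_vecI\<close>)
  next
    fix xs :: "(nat \<Rightarrow> rat) list" and t assume xs: "length xs = n" "set xs \<subseteq> int_box n t"
    \<comment> \<open>Entries of box vectors are integers, so taking floors changes nothing and the
      determinant comes from an integer matrix.\<close>
    have "row_mat n xs = map_mat of_int (mat n n (\<lambda>(i, j). \<lfloor>(xs ! i) j\<rfloor>))"
    proof (rule eq_matI)
      fix i j assume "i < dim_row (map_mat of_int (mat n n (\<lambda>(i, j). \<lfloor>(xs ! i) j\<rfloor>)) :: rat mat)"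
        "j < dim_col (map_mat of_int (mat n n (\<lambda>(i, j). \<lfloor>(xs ! i) j\<rfloor>)) :: rat mat)"
      moreover from this have "xs ! i \<in> int_box n t" using xs by (intro subsetD[OF xs(2) nth_mem]) auto
      moreover from this have "(xs ! i) j \<in> \<int>" by (simp add: int_box_def)
      ultimately show "row_mat n xs $$ (i, j) = map_mat of_int (mat n n (\<lambda>(i, j). \<lfloor>(xs ! i) j\<rfloor>)) $$ (i, j)"
        by (simp add: row_mat_def)
    qed (auto simp: row_mat_def)
    then show "det (row_mat n xs) \<in> \<int>" by (simp add: of_int_hom.hom_det)
  qed
qed

definition mat_rows :: "nat \<Rightarrow> int mat \<Rightarrow> (nat \<Rightarrow> rat) list" where
  "mat_rows n A = map (\<lambda>i j. if j < n then of_int (A $$ (i, j)) else 0) [0..<n]"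

lemma inj_on_mat_rows: "inj_on (mat_rows n) (carrier_mat n n)"
proof (rule inj_onI)
  fix A A' :: "int mat"
  assume AA: "A \<in> carrier_mat n n" "A' \<in> carrier_mat n n" and eq: "mat_rows n A = mat_rows n A'"
  have "A $$ (i, j) = A' $$ (i, j)" if "i < n" "j < n" for i j
    using fun_cong[OF arg_cong[OF eq, of "\<lambda>xs. xs ! i"], of j] that by (simp add: mat_rows_def)
  then show "A = A'" using AA by (intro eq_matI) auto
qed

lemma det_row_mat_mat_rows: "A \<in> carrier_mat n n \<Longrightarrow> det (row_mat n (mat_rows n A)) = of_int (det A)"
proof -
  assume "A \<in> carrier_mat n n"
  then have "row_mat n (mat_rows n A) = map_mat of_int A"
    by (intro eq_matI) (auto simp: row_mat_def mat_rows_def)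
  then show ?thesis by (simp add: of_int_hom.hom_det)
qed

lemma bounded_int_mats_entry:
  assumes "A \<in> bounded_int_mats n (real h)" "i < n" "j < n"
  shows "\<bar>A $$ (i, j)\<bar> \<le> int h"
proof -
  have "of_int \<bar>A $$ (i, j)\<bar> \<le> (of_int (int h) :: real)"
    using assms by (simp add: bounded_int_mats_def)
  then show ?thesis by (simp only: of_int_le_iff)
qed

lemma mat_rows_int_box:
  assumes A: "A \<in> bounded_int_mats n (real h)"
  shows "length (mat_rows n A) = n \<and> set (mat_rows n A) \<subseteq> int_box n h"
proof -
  have "\<bar>of_int (A $$ (i, j))\<bar> \<le> (of_nat h :: rat)" if "i < n" "j < n" for i j
  proof -
    have "of_int \<bar>A $$ (i, j)\<bar> \<le> (of_int (int h) :: rat)"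
      using bounded_int_mats_entry[OF A that] by (simp only: of_int_le_iff)
    then show ?thesis by simp
  qed
  then show ?thesis by (auto simp: mat_rows_def int_box_def)
qed

lemma bounded_int_mats_carrier: "bounded_int_mats n H \<subseteq> carrier_mat n n"
  by (auto simp: bounded_int_mats_def)

lemma card_bounded_int_mats_le: "card (bounded_int_mats n (real h)) \<le> (2 * h + 1) ^ (n * n)"
proof -
  have "card (bounded_int_mats n (real h)) \<le> card {as. set as \<subseteq> int_box n h \<and> length as = n}"
    using mat_rows_int_box
    by (intro card_inj_on_le[OF inj_on_subset[OF inj_on_mat_rows bounded_int_mats_carrier]]
        finite_lists_length_eq int_rows.finite_box) blast
  also have "\<dots> = (2 * h + 1) ^ (n * n)"
    by (simp add: card_lists_length_eq int_rows.finite_box card_int_box power_mult)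
  finally show ?thesis .
qed

text \<open>Passing to rows turns this into a level set of the form. The factor
  \<open>(4 * h + 1) ^ n\<close> is the number of points of the box of size
  \<open>2 * h\<close>.\<close>

lemma card_det_eq_le:
  assumes "d \<noteq> 0"
  shows "card {A \<in> bounded_int_mats n (real h). det A = d} * (4 * h + 1) ^ n
    \<le> card {v. v dvd d ^ (n + 1)} ^ n * (2 ^ (n * n) * (2 * (n + 2) * h + 1) ^ (n * n))"
proof -
  let ?M = "{A \<in> bounded_int_mats n (real h). det A = d}"
  let ?S = "{as. length as = n \<and> set as \<subseteq> int_box n h \<and> det (row_mat n as) = of_int d}"
  have "card ?M \<le> card ?S"
  proof (rule card_inj_on_le)
    show "inj_on (mat_rows n) ?M"
      using bounded_int_mats_carrier by (intro inj_on_subset[OF inj_on_mat_rows]) blast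
    show "mat_rows n ` ?M \<subseteq> ?S"
      using mat_rows_int_box det_row_mat_mat_rows bounded_int_mats_carrier by blast
    show "finite ?S"
      by (rule finite_subset[OF _ finite_lists_length_eq[OF int_rows.finite_box, of n h n]]) auto
  qed
  then have "card ?M * card (int_box n (2 * h)) \<le> card ?S * card (int_box n (2 * h))"
    by (rule mult_right_mono) simp
  also have "\<dots> \<le> card {v. v dvd d ^ (n + 1)} ^ n * (2 ^ (n * n) * card (int_box n ((n + 2) * h)) ^ n)"
    using assms by (rule int_rows.card_form_level_set_le)
  finally show ?thesis by (simp add: card_int_box power_mult mult.assoc)
qed

subsection \<open>Determinants of words\<close>

text \<open>The determinant is multiplicative on the group. Membership in the carrier is proved
  along with it because the induction step needs it for the tail of the word.\<close>

lemma word_value_det: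
  assumes As: "set As \<subseteq> carrier_mat n n" "\<forall>A\<in>set As. det A \<noteq> 0" "length As = s"
    and w: "\<forall>(i, e)\<in>set w. i < s \<and> (e = 1 \<or> e = -1)"
  shows "word_value n As w \<in> carrier (GL_rat n) \<and>
    det (word_value n As w) = (\<Prod>(i, e)\<leftarrow>w. of_int (det (As ! i)) powi e)"
proof -
  let ?R = "ring_mat TYPE(rat) n ()" and ?G = "GL_rat n"
  interpret R: ring ?R by (rule ring_mat)
  interpret G: group ?G unfolding GL_rat_def by (rule R.units_group)
  have mult: "x \<otimes>\<^bsub>?G\<^esub> y = x * y" and one: "\<one>\<^bsub>?G\<^esub> = 1\<^sub>m n" for x y
    by (simp_all add: GL_rat_def units_of_mult units_of_one ring_mat_simps)
  have carrier: "A \<in> carrier_mat n n" if "A \<in> carrier ?G" for A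
    using that by (auto simp: GL_rat_def units_of_carrier Units_def ring_mat_def)
  have det_hom: "det (x \<otimes>\<^bsub>?G\<^esub> y) = det x * det y" if "x \<in> carrier ?G" "y \<in> carrier ?G" for x y
    unfolding mult using that carrier by (intro det_mult[of _ n]) auto
  have letter: "map_mat of_int (As ! i) [^]\<^bsub>?G\<^esub> e \<in> carrier ?G \<and>
      det (map_mat of_int (As ! i) [^]\<^bsub>?G\<^esub> e) = of_int (det (As ! i)) powi e"
    if ie: "i < s" "e = 1 \<or> e = -1" for i and e :: int
  proof -
    let ?A = "map_mat of_int (As ! i) :: rat mat"
    have "As ! i \<in> set As" using ie As by simp
    then have A: "As ! i \<in> carrier_mat n n" "det (As ! i) \<noteq> 0" using As by auto
    have d: "det ?A = of_int (det (As ! i))" by (rule of_int_hom.hom_det)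
    have AG: "?A \<in> carrier ?G"
      unfolding GL_rat_def units_of_carrier using A by (intro det_non_zero_imp_unit) (auto simp: d)
    have "det (inv\<^bsub>?G\<^esub> ?A) * det ?A = 1"
      using det_hom[OF G.inv_closed[OF AG] AG] AG by (simp add: one)
    then have "of_int (det (As ! i)) * det (inv\<^bsub>?G\<^esub> ?A) = 1" by (simp add: d mult.commute)
    then have "det (inv\<^bsub>?G\<^esub> ?A) = inverse (of_int (det (As ! i)))"
      by (rule inverse_unique[symmetric])
    then show ?thesis
      using ie AG d G.int_pow_neg[OF AG, of 1] by (auto simp: power_int_minus)
  qed
  show ?thesis using w
  proof (induction w)
    case Nil
    then show ?case using G.one_closed by (simp add: word_value_def one)
  next
    case (Cons l w)
    obtain i e where l: "l = (i, e)" by force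
    have "word_value n As (l # w) = map_mat of_int (As ! i) [^]\<^bsub>?G\<^esub> e \<otimes>\<^bsub>?G\<^esub> word_value n As w"
      by (simp add: word_value_def l)
    then show ?case using Cons letter[of i e] by (auto simp: l det_hom)
  qed
qed

text \<open>In a field the order of the letters is lost and only exponent sums survive. The bases
  are nonzero so that exponents add.\<close>

lemma prod_list_letters_powi:
  fixes x :: "nat \<Rightarrow> 'a :: field"
  assumes "\<And>i. i < s \<Longrightarrow> x i \<noteq> 0" "\<forall>(i, e)\<in>set w. i < s"
  shows "(\<Prod>(i, e)\<leftarrow>w. x i powi e) = (\<Prod>i<s. x i powi exponent_sum i w)"
  using assms(2)
proof (induction w)
  case Nil
  then show ?case by (simp add: exponent_sum_def)
next
  case (Cons l w)
  obtain j e where l: "l = (j, e)" by force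
  have j: "j < s" using Cons.prems by (simp add: l)
  have "(\<Prod>i<s. x i powi exponent_sum i (l # w))
      = (\<Prod>i<s. x i powi (if j = i then e else 0) * x i powi exponent_sum i w)"
    using assms(1) by (intro prod.cong refl) (simp add: exponent_sum_def l power_int_add)
  also have "\<dots> = (\<Prod>i<s. x i powi (if j = i then e else 0)) * (\<Prod>i<s. x i powi exponent_sum i w)"
    by (rule prod.distrib)
  also have "(\<Prod>i<s. x i powi (if j = i then e else 0)) = (\<Prod>i<s. if j = i then x i powi e else 1)"
    by (intro prod.cong) auto
  also have "\<dots> = x j powi e" using j by simp
  finally show ?case using Cons by (simp add: l)
qed

text \<open>Negating all exponents if necessary, \<open>E j\<close> is positive. Moving the
  nonpositive exponents to the other side gives an identity of integers, and \<open>p\<close>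
  divides its left side. Hence \<open>p\<close> divides some \<open>d i\<close> with
  \<open>E i\<close> not positive, so that \<open>i\<close> is not \<open>j\<close>.\<close>

lemma prime_dvd_other_if_powi_prod_eq_1:
  fixes d E :: "nat \<Rightarrow> int"
  assumes nz: "\<And>i. i < s \<Longrightarrow> d i \<noteq> 0"
    and prod: "(\<Prod>i<s. of_int (d i) powi E i) = (1 :: rat)"
    and j: "j < s" "E j \<noteq> 0" and p: "prime p" "p dvd d j"
  shows "\<exists>i<s. i \<noteq> j \<and> p dvd d i"
proof -
  have pos: "\<exists>i<s. i \<noteq> j \<and> p dvd d i"
    if prod: "(\<Prod>i<s. of_int (d i) powi E i) = (1 :: rat)" and Ej: "E j > 0" for E :: "nat \<Rightarrow> int"
  proof -
    have eq_if: "a = b" if "1 = a * inverse b" "b \<noteq> 0" for a b :: rat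
      using that by (simp add: field_simps)
    let ?P = "{i \<in> {..<s}. E i > 0}" and ?N = "{i \<in> {..<s}. \<not> E i > 0}"
    have N: "(\<Prod>i\<in>?N. of_int (d i) powi E i) = inverse (\<Prod>i\<in>?N. of_int (d i) ^ nat (- E i) :: rat)"
      unfolding prod_inversef[symmetric]
      by (intro prod.cong) (auto simp: power_int_def power_inverse)
    have "(\<Prod>i<s. of_int (d i) powi E i) = (\<Prod>i\<in>?P. of_int (d i) powi E i) * (\<Prod>i\<in>?N. of_int (d i) powi E i :: rat)"
      by (subst prod.union_disjoint[symmetric]) (auto intro!: prod.cong)
    also have "(\<Prod>i\<in>?P. of_int (d i) powi E i) = (\<Prod>i\<in>?P. of_int (d i) ^ nat (E i) :: rat)"
      by (intro prod.cong) (auto simp: power_int_def)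
    finally have eq1: "1 = (\<Prod>i\<in>?P. of_int (d i) ^ nat (E i) :: rat) * inverse (\<Prod>i\<in>?N. of_int (d i) ^ nat (- E i))"
      unfolding prod N .
    have "(\<Prod>i\<in>?N. of_int (d i) ^ nat (- E i) :: rat) \<noteq> 0" using nz by simp
    with eq1 have "(\<Prod>i\<in>?P. of_int (d i) ^ nat (E i) :: rat) = (\<Prod>i\<in>?N. of_int (d i) ^ nat (- E i))"
      by (rule eq_if)
    then have "of_int (\<Prod>i\<in>?P. d i ^ nat (E i)) = (of_int (\<Prod>i\<in>?N. d i ^ nat (- E i)) :: rat)"
      by simp
    then have eq: "(\<Prod>i\<in>?P. d i ^ nat (E i)) = (\<Prod>i\<in>?N. d i ^ nat (- E i))"
      by (simp only: of_int_eq_iff)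
    have "p dvd d j ^ nat (E j)" using p Ej by (intro dvd_power_le[of p "d j" 1, simplified]) auto
    also have "\<dots> dvd (\<Prod>i\<in>?P. d i ^ nat (E i))" using j Ej by (intro dvd_prodI) auto
    finally have "p dvd (\<Prod>i\<in>?N. d i ^ nat (- E i))" unfolding eq .
    then obtain i where i: "i \<in> ?N" "p dvd d i ^ nat (- E i)"
      using p by (subst (asm) prime_dvd_prod_iff) auto
    then show ?thesis using Ej prime_dvd_power[OF p(1) i(2)] by blast
  qed
  show ?thesis
  proof (cases "E j > 0")
    case True
    then show ?thesis using pos prod by blast
  next
    case False
    have "(\<Prod>i<s. of_int (d i) powi (- E i)) = inverse (\<Prod>i<s. of_int (d i) powi E i :: rat)"
      unfolding prod_inversef[symmetric] by (intro prod.cong) (auto simp: power_int_minus)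
    then show ?thesis using False j pos[of "\<lambda>i. - E i"] by (simp add: prod)
  qed
qed

text \<open>This is all that the count takes from the relation. For \<open>s = 1\<close> there is no
  other index, and the determinant is 1 or -1.\<close>

lemma K_tuples_prime_dvd_det:
  assumes "As \<in> K_tuples n s H"
  shows "\<exists>j<s. \<forall>p. prime p \<longrightarrow> p dvd det (As ! j) \<longrightarrow> (\<exists>i<s. i \<noteq> j \<and> p dvd det (As ! i))"
proof -
  from assms obtain w j where As: "length As = s" "set As \<subseteq> bounded_int_mats n H" "\<forall>A\<in>set As. det A \<noteq> 0"
    and w: "is_word s w" "word_value n As w = \<one>\<^bsub>GL_rat n\<^esub>" and j: "j < s" "exponent_sum j w \<noteq> 0"
    by (auto simp: K_tuples_def)
  have nz: "det (As ! i) \<noteq> 0" if "i < s" for i using As that by simp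
  have "set As \<subseteq> carrier_mat n n" using As by (auto simp: bounded_int_mats_def)
  then have "det (word_value n As w) = (\<Prod>(i, e)\<leftarrow>w. of_int (det (As ! i)) powi e)"
    using word_value_det[of As n s w] As w by (auto simp: is_word_def)
  also have "\<dots> = (\<Prod>i<s. of_int (det (As ! i)) powi exponent_sum i w)"
    using nz w by (intro prod_list_letters_powi) (auto simp: is_word_def)
  finally have "(\<Prod>i<s. of_int (det (As ! i)) powi exponent_sum i w) = (1 :: rat)"
    by (simp add: w GL_rat_def units_of_one ring_mat_simps)
  from prime_dvd_other_if_powi_prod_eq_1[OF nz this j] show ?thesis using j by blast
qed

subsection \<open>The count\<close>

lemma abs_det_le:
  assumes A: "A \<in> bounded_int_mats n (real h)"
  shows "nat \<bar>det A\<bar> \<le> fact n * h ^ n"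
proof -
  have entry: "\<bar>A $$ (i, p i)\<bar> \<le> int h" if "p permutes {0..<n}" "i \<in> {0..<n}" for p i
    using permutes_in_image[OF that(1), of i] that A by (intro bounded_int_mats_entry) auto
  have "\<bar>det A\<bar> \<le> (\<Sum>p | p permutes {0..<n}. \<bar>signof p * (\<Prod>i = 0..<n. A $$ (i, p i))\<bar>)"
    using A bounded_int_mats_carrier[of n "real h"] by (subst det_def'[of A n]) auto
  also have "\<dots> \<le> (\<Sum>p | p permutes {0..<n}. int h ^ n)"
  proof (rule sum_mono)
    fix p assume p: "p \<in> {p. p permutes {0..<n}}"
    have "\<bar>signof p * (\<Prod>i = 0..<n. A $$ (i, p i))\<bar> = (\<Prod>i = 0..<n. \<bar>A $$ (i, p i)\<bar>)"
      by (simp add: abs_mult abs_prod sign_def)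
    also have "\<dots> \<le> (\<Prod>i = 0..<n. int h)"
      using p entry by (intro prod_mono) auto
    finally show "\<bar>signof p * (\<Prod>i = 0..<n. A $$ (i, p i))\<bar> \<le> int h ^ n" by simp
  qed
  also have "\<dots> = int (fact n * h ^ n)" by (simp add: card_permutations)
  finally show ?thesis by (simp add: nat_le_iff)
qed

lemma power_eq_powr: "h \<ge> 1 \<Longrightarrow> real h ^ k = real h powr real k"
  by (simp add: powr_realpow)

lemma card_det_eq_bound:
  fixes e :: real
  assumes e: "e > 0"
  shows "\<exists>C>0. \<forall>h\<ge>1. \<forall>d. d \<noteq> 0 \<longrightarrow>
    real (card {A \<in> bounded_int_mats n (real h). det A = d}) \<le> C * real h powr (real n ^ 2 - real n + e)"
proof -
  \<comment> \<open>The square of |d|^(n+1) is at most a constant times h^m, as |d| <= n! h^n. The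
    divisor count enters to the power \<open>n\<close>, so \<open>n * m * \<delta>\<close> must not
    exceed \<open>e\<close>; the added 1 keeps the denominator positive for
    \<open>n = 0\<close>.\<close>
  define m where "m = n * (2 * (n + 1))"
  define \<delta> where "\<delta> = e / (real (n * m) + 1)"
  have \<delta>: "\<delta> > 0" using e by (simp add: \<delta>_def add_nonneg_pos)
  have n_m: "real n * (real m * \<delta>) \<le> e"
  proof -
    have "real n * (real m * \<delta>) = e * (real (n * m) / (real (n * m) + 1))" by (simp add: \<delta>_def)
    also have "\<dots> \<le> e * 1" using e by (intro mult_left_mono) (auto simp: pos_divide_le_eq add_nonneg_pos)
    finally show ?thesis by simp
  qed
  obtain K where K: "K > 0" and supp: "\<And>X Q::nat. Q > 0 \<Longrightarrow>
      finite {d::int. d \<noteq> 0 \<and> nat \<bar>d\<bar> \<le> X \<and> prime_factors (nat \<bar>d\<bar>) \<subseteq> prime_factors Q} \<and>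
      real (card {d::int. d \<noteq> 0 \<and> nat \<bar>d\<bar> \<le> X \<and> prime_factors (nat \<bar>d\<bar>) \<subseteq> prime_factors Q})
        \<le> K * (real X * real Q) powr \<delta>"
    using card_prime_support_bound[OF \<delta>] by blast
  define F where "F = real (fact n ^ (2 * (n + 1)))"
  define C where "C = (K * F powr \<delta>) ^ n * (2 ^ (n * n) * (2 * real n + 5) ^ (n * n))"
  have F: "F > 0" by (simp add: F_def)
  have C: "C > 0" using K F by (simp add: C_def)
  have "real (card {A \<in> bounded_int_mats n (real h). det A = d}) \<le> C * real h powr (real n ^ 2 - real n + e)"
    if h: "h \<ge> 1" and d: "d \<noteq> 0" for h :: nat and d :: int
  proof (cases "{A \<in> bounded_int_mats n (real h). det A = d} = {}")
    case True
    then show ?thesis using C by (simp only: card.empty) simp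
  next
    case False
    let ?N = "card {A \<in> bounded_int_mats n (real h). det A = d}"
    let ?T = "card {v. v dvd d ^ (n + 1)}"
    let ?Q = "nat \<bar>d ^ (n + 1)\<bar>"
    \<comment> \<open>A matrix in the set is what bounds \<open>d\<close>; otherwise the count is
      zero.\<close>
    have dX: "nat \<bar>d\<bar> \<le> fact n * h ^ n" using False abs_det_le by blast
    have Q: "?Q > 0" using d by simp
    have "?Q = nat \<bar>d\<bar> ^ (n + 1)" by (simp add: power_abs nat_power_eq abs_mult nat_mult_distrib)
    also have "\<dots> \<le> (fact n * h ^ n) ^ (n + 1)" using dX by (rule power_mono) simp
    finally have "real ?Q \<le> real ((fact n * h ^ n) ^ (n + 1))" by (simp only: of_nat_le_iff)
    then have "real ?Q * real ?Q \<le> real ((fact n * h ^ n) ^ (n + 1)) * real ((fact n * h ^ n) ^ (n + 1))"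
      by (intro mult_mono) auto
    also have "\<dots> = real ((fact n * h ^ n) ^ (2 * (n + 1)))"
      by (simp only: mult_2 power_add of_nat_mult)
    also have "\<dots> = F * real h ^ m"
      by (simp only: F_def m_def power_mult_distrib power_mult of_nat_mult of_nat_power)
    finally have QQ: "real ?Q * real ?Q \<le> F * real h powr real m" using h by (simp add: power_eq_powr)
    \<comment> \<open>Divisors of \<open>?Q\<close> are integers up to \<open>?Q\<close> with no new
      primes, so the prime support bound also bounds the number of divisors.\<close>
    have "{v. v dvd d ^ (n + 1)}
        \<subseteq> {v. v \<noteq> 0 \<and> nat \<bar>v\<bar> \<le> ?Q \<and> prime_factors (nat \<bar>v\<bar>) \<subseteq> prime_factors ?Q}"
    proof
      fix v assume "v \<in> {v. v dvd d ^ (n + 1)}"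
      then have v: "v dvd d ^ (n + 1)" by simp
      then have "nat \<bar>v\<bar> dvd ?Q" by simp
      moreover have "v \<noteq> 0" using v d by auto
      ultimately show "v \<in> {v. v \<noteq> 0 \<and> nat \<bar>v\<bar> \<le> ?Q \<and> prime_factors (nat \<bar>v\<bar>) \<subseteq> prime_factors ?Q}"
        using Q dvd_imp_le[of "nat \<bar>v\<bar>" ?Q] dvd_prime_factors[of ?Q "nat \<bar>v\<bar>"] by simp
    qed
    then have "real ?T \<le> K * (real ?Q * real ?Q) powr \<delta>"
      using supp[OF Q, of ?Q] by (meson card_mono of_nat_le_iff order_trans)
    also have "\<dots> \<le> K * (F * real h powr real m) powr \<delta>"
      using QQ K \<delta> by (intro mult_left_mono powr_mono2) auto
    also have "\<dots> = (K * F powr \<delta>) * real h powr (real m * \<delta>)"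
      using F by (simp add: powr_mult powr_powr)
    finally have "real ?T ^ n \<le> ((K * F powr \<delta>) * real h powr (real m * \<delta>)) ^ n"
      by (rule power_mono) simp
    also have "\<dots> = (K * F powr \<delta>) ^ n * real h powr (real n * (real m * \<delta>))"
      using h by (simp add: power_mult_distrib powr_power mult.commute)
    also have "\<dots> \<le> (K * F powr \<delta>) ^ n * real h powr e"
      using h n_m K by (intro mult_left_mono powr_mono) auto
    finally have T: "real ?T ^ n \<le> (K * F powr \<delta>) ^ n * real h powr e" .
    \<comment> \<open>Of the factor on the left only h^n is kept; it is cancelled at the
      end.\<close>
    have "real ?N * real h ^ n \<le> real ?N * (4 * real h + 1) ^ n"
      by (intro mult_left_mono power_mono) auto
    also have "\<dots> = real (?N * (4 * h + 1) ^ n)" by (simp add: add.commute)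
    also have "\<dots> \<le> real (?T ^ n * (2 ^ (n * n) * (2 * (n + 2) * h + 1) ^ (n * n)))"
      using card_det_eq_le[OF d, of n h] by (simp only: of_nat_le_iff)
    also have "\<dots> = real ?T ^ n * (2 ^ (n * n) * (2 * (real n + 2) * real h + 1) ^ (n * n))"
      by (simp add: algebra_simps)
    also have "\<dots> \<le> ((K * F powr \<delta>) ^ n * real h powr e) * (2 ^ (n * n) * ((2 * real n + 5) * real h) ^ (n * n))"
      using T h K by (intro mult_mono power_mono) (auto simp: algebra_simps)
    also have "\<dots> = C * (real h powr e * real h ^ (n * n))"
      by (simp add: C_def power_mult_distrib)
    finally have "real ?N * real h powr real n \<le> C * (real h powr e * real h powr real (n * n))"
      using h by (simp only: power_eq_powr)
    then have "real ?N * real h powr real n * real h powr (- real n)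
        \<le> C * (real h powr e * real h powr real (n * n)) * real h powr (- real n)"
      by (rule mult_right_mono) simp
    moreover have "real h powr real n * real h powr (- real n) = 1"
      using h by (simp flip: powr_add)
    moreover have "real h powr e * (real h powr real (n * n) * real h powr (- real n))
        = real h powr (real n ^ 2 - real n + e)"
      by (simp add: power2_eq_square algebra_simps flip: powr_add)
    ultimately show ?thesis by (simp only: mult.assoc mult_1_right)
  qed
  then show ?thesis using C by blast
qed

lemma prod_list_le_power:
  fixes f :: "'a \<Rightarrow> nat"
  assumes "\<And>x. x \<in> set xs \<Longrightarrow> f x \<le> b"
  shows "(\<Prod>x\<leftarrow>xs. f x) \<le> b ^ length xs"
  using assms by (induction xs) (auto intro!: mult_mono)

text \<open>Choose the index \<open>j\<close>, the other matrices freely, then the determinant of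
  the j-th one among at most \<open>a\<close> values, then the matrix itself among at most
  \<open>b\<close>.\<close>

lemma card_K_tuples_le:
  assumes Z: "\<And>Q::nat. 0 < Q \<Longrightarrow> Q \<le> (fact n * h ^ n) ^ (s - 1) \<Longrightarrow>
      finite {d::int. d \<noteq> 0 \<and> nat \<bar>d\<bar> \<le> fact n * h ^ n \<and> prime_factors (nat \<bar>d\<bar>) \<subseteq> prime_factors Q} \<and>
      real (card {d::int. d \<noteq> 0 \<and> nat \<bar>d\<bar> \<le> fact n * h ^ n \<and> prime_factors (nat \<bar>d\<bar>) \<subseteq> prime_factors Q}) \<le> a"
    and N: "\<And>d. d \<noteq> 0 \<Longrightarrow> real (card {A \<in> bounded_int_mats n (real h). det A = d}) \<le> b"
    and nonneg: "0 \<le> a" "0 \<le> b"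
  shows "real (card (K_tuples n s (real h))) \<le> real s * (real ((2 * h + 1) ^ (n * n * (s - 1))) * (a * b))"
proof -
  let ?M = "bounded_int_mats n (real h)" and ?X = "fact n * h ^ n :: nat"
  let ?q = "\<lambda>Bs :: int mat list. \<Prod>B\<leftarrow>Bs. nat \<bar>det B\<bar>"
  define G where "G = {A \<in> ?M. det A \<noteq> 0}"
  define L where "L = {Bs. set Bs \<subseteq> G \<and> length Bs = s - 1}"
  define S where "S = (\<lambda>Q. {d::int. d \<noteq> 0 \<and> nat \<bar>d\<bar> \<le> ?X \<and> prime_factors (nat \<bar>d\<bar>) \<subseteq> prime_factors Q})"
  define R where "R = (\<lambda>Bs. \<Union>d\<in>S (?q Bs). {A \<in> ?M. det A = d})"
  have finG: "finite G" unfolding G_def by (simp add: finite_bounded_int_mats)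
  have finL: "finite L" unfolding L_def using finG by (rule finite_lists_length_eq)
  \<comment> \<open>The product must be nonzero because \<open>prime_factors 0\<close> is empty. For
    \<open>s = 1\<close> the list is empty and the product is 1.\<close>
  have q: "0 < ?q Bs \<and> ?q Bs \<le> ?X ^ (s - 1)" if "Bs \<in> L" for Bs
  proof -
    have "?q Bs \<noteq> 0" unfolding prod_list_zero_iff using that by (auto simp: L_def G_def subset_iff)
    moreover have "?q Bs \<le> ?X ^ length Bs"
      using that abs_det_le by (intro prod_list_le_power) (auto simp: L_def G_def)
    ultimately show ?thesis using that by (simp add: L_def del: prod_list_zero_iff)
  qed
  have finR: "finite (R Bs)" for Bs
    by (rule finite_subset[OF _ finite_bounded_int_mats[of n "real h"]]) (auto simp: R_def)
  have cardR: "real (card (R Bs)) \<le> a * b" if Bs: "Bs \<in> L" for Bs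
  proof -
    have S: "finite (S (?q Bs))" "real (card (S (?q Bs))) \<le> a" using Z[of "?q Bs"] q[OF Bs] by (auto simp: S_def)
    have "real (card (R Bs)) \<le> (\<Sum>d\<in>S (?q Bs). real (card {A \<in> ?M. det A = d}))"
      unfolding R_def of_nat_sum[symmetric] of_nat_le_iff using S(1) by (rule card_UN_le)
    also have "\<dots> \<le> (\<Sum>d\<in>S (?q Bs). b)" using N by (intro sum_mono) (auto simp: S_def)
    also have "\<dots> = real (card (S (?q Bs))) * b" by simp
    also have "\<dots> \<le> a * b" using S(2) nonneg by (intro mult_right_mono)
    finally show ?thesis .
  qed
  let ?glue = "\<lambda>j (Bs, A). take j Bs @ A # drop j Bs :: int mat list"
  have sub: "K_tuples n s (real h) \<subseteq> (\<Union>j<s. ?glue j ` Sigma L R)"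
  proof
    fix As assume As: "As \<in> K_tuples n s (real h)"
    then have As': "length As = s" "set As \<subseteq> G" by (auto simp: K_tuples_def G_def)
    obtain j where j: "j < s"
      and p: "\<And>p. prime p \<Longrightarrow> p dvd det (As ! j) \<Longrightarrow> \<exists>i<s. i \<noteq> j \<and> p dvd det (As ! i)"
      using K_tuples_prime_dvd_det[OF As] by blast
    define Bs where "Bs = take j As @ drop (Suc j) As"
    have Bs: "Bs \<in> L" using As' j set_take_subset[of j As] set_drop_subset[of "Suc j" As]
      by (auto simp: L_def Bs_def)
    have mem: "As ! i \<in> set Bs" if "i < s" "i \<noteq> j" for i
    proof (cases "i < j")
      case True
      then have "As ! i = take j As ! i" "i < length (take j As)" using As' that by auto
      then show ?thesis unfolding Bs_def by (metis Un_iff nth_mem set_append)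
    next
      case False
      then have "As ! i = drop (Suc j) As ! (i - Suc j)" "i - Suc j < length (drop (Suc j) As)"
        using As' that by auto
      then show ?thesis unfolding Bs_def by (metis Un_iff nth_mem set_append)
    qed
    have Aj: "As ! j \<in> G" using As' j by auto
    have "prime_factors (nat \<bar>det (As ! j)\<bar>) \<subseteq> prime_factors (?q Bs)"
    proof
      fix r assume r: "r \<in> prime_factors (nat \<bar>det (As ! j)\<bar>)"
      then have "prime r" "int r dvd det (As ! j)" by (auto simp: in_prime_factors_iff)
      then obtain i where i: "i < s" "i \<noteq> j" "int r dvd det (As ! i)" using p[of "int r"] by auto
      then have "r dvd nat \<bar>det (As ! i)\<bar>" by simp
      also have "\<dots> dvd ?q Bs" using mem[OF i(1,2)] by (intro prod_list_dvd) auto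
      finally show "r \<in> prime_factors (?q Bs)"
        using q[OF Bs] \<open>prime r\<close> by (intro prime_factorsI) linarith+
    qed
    then have "As ! j \<in> R Bs"
      using Aj abs_det_le[of "As ! j" n h] by (auto simp: R_def S_def G_def)
    moreover have "As = ?glue j (Bs, As ! j)"
      using j As' id_take_nth_drop[of j As] by (simp add: Bs_def min_def)
    ultimately show "As \<in> (\<Union>j<s. ?glue j ` Sigma L R)" using Bs j by blast
  qed
  have "card (K_tuples n s (real h)) \<le> card (\<Union>j<s. ?glue j ` Sigma L R)"
    using finL finR by (intro card_mono sub) auto
  also have "\<dots> \<le> (\<Sum>j<s. card (?glue j ` Sigma L R))" by (rule card_UN_le) simp
  also have "\<dots> \<le> (\<Sum>j<s. card (Sigma L R))"
    using finL finR by (intro sum_mono card_image_le) auto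
  also have "\<dots> = s * (\<Sum>Bs\<in>L. card (R Bs))" using finL finR by simp
  finally have "real (card (K_tuples n s (real h))) \<le> real s * (\<Sum>Bs\<in>L. real (card (R Bs)))"
    by (simp flip: of_nat_sum of_nat_mult)
  also have "\<dots> \<le> real s * (\<Sum>Bs\<in>L. a * b)" using cardR by (intro mult_left_mono sum_mono) auto
  also have "\<dots> = real s * (real (card L) * (a * b))" by simp
  also have "\<dots> \<le> real s * (real ((2 * h + 1) ^ (n * n * (s - 1))) * (a * b))"
  proof -
    have "card G \<le> card ?M"
      by (intro card_mono finite_bounded_int_mats) (auto simp: G_def)
    also have "\<dots> \<le> (2 * h + 1) ^ (n * n)" by (rule card_bounded_int_mats_le)
    finally have "card G ^ (s - 1) \<le> ((2 * h + 1) ^ (n * n)) ^ (s - 1)" by (rule power_mono) simp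
    then have "card L \<le> (2 * h + 1) ^ (n * n * (s - 1))"
      using card_lists_length_eq[OF finG, of "s - 1"] by (simp add: L_def power_mult)
    then show ?thesis using nonneg
      by (intro mult_left_mono mult_right_mono mult_nonneg_nonneg) (simp_all only: of_nat_le_iff of_nat_0_le_iff)
  qed
  finally show ?thesis .
qed


lemma card_K_tuples_bound:
  fixes e :: real
  assumes e: "e > 0" and s: "s \<ge> 1"
  shows "\<exists>C>0. \<forall>h\<ge>1. real (card (K_tuples n s (real h)))
    \<le> C * real h powr (real s * real n ^ 2 - real n + e)"
proof -
  \<comment> \<open>Half of \<open>e\<close> pays for the number of determinants, the other half for
    the matrices of each determinant.\<close>
  define \<delta> where "\<delta> = e / 2 / (real (n * s) + 1)"
  have \<delta>: "\<delta> > 0" using e by (simp add: \<delta>_def add_nonneg_pos)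
  have ns: "real (n * s) * \<delta> \<le> e / 2"
  proof -
    have "real (n * s) * \<delta> = e / 2 * (real (n * s) / (real (n * s) + 1))" by (simp add: \<delta>_def)
    also have "\<dots> \<le> e / 2 * 1" using e by (intro mult_left_mono) (auto simp: pos_divide_le_eq add_nonneg_pos)
    finally show ?thesis by simp
  qed
  obtain K where K: "K > 0" and supp: "\<And>X Q::nat. Q > 0 \<Longrightarrow>
      finite {d::int. d \<noteq> 0 \<and> nat \<bar>d\<bar> \<le> X \<and> prime_factors (nat \<bar>d\<bar>) \<subseteq> prime_factors Q} \<and>
      real (card {d::int. d \<noteq> 0 \<and> nat \<bar>d\<bar> \<le> X \<and> prime_factors (nat \<bar>d\<bar>) \<subseteq> prime_factors Q})
        \<le> K * (real X * real Q) powr \<delta>"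
    using card_prime_support_bound[OF \<delta>] by blast
  obtain C1 where C1: "C1 > 0" and dets: "\<And>h d. h \<ge> 1 \<Longrightarrow> d \<noteq> 0 \<Longrightarrow>
      real (card {A \<in> bounded_int_mats n (real h). det A = d}) \<le> C1 * real h powr (real n ^ 2 - real n + e / 2)"
    using card_det_eq_bound[of "e / 2" n] e by auto
  define F where "F = real (fact n ^ s)"
  define k where "k = n * n * (s - 1)"
  define C where "C = real s * 3 ^ k * (K * F powr \<delta>) * C1"
  have C: "C > 0" using s K C1 by (simp add: C_def F_def)
  have "real (card (K_tuples n s (real h))) \<le> C * real h powr (real s * real n ^ 2 - real n + e)"
    if h: "h \<ge> 1" for h :: nat
  proof -
    let ?X = "fact n * h ^ n :: nat"
    let ?a = "K * F powr \<delta> * real h powr (e / 2)"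
    let ?b = "C1 * real h powr (real n ^ 2 - real n + e / 2)"
    have "real (card (K_tuples n s (real h))) \<le> real s * (real ((2 * h + 1) ^ k) * (?a * ?b))"
      unfolding k_def
    proof (rule card_K_tuples_le)
      fix Q :: nat assume Q: "0 < Q" "Q \<le> ?X ^ (s - 1)"
      \<comment> \<open>One determinant and the product of the other \<open>s - 1\<close> together
        amount to at most (n! h^n)^s.\<close>
      have "?X * Q \<le> ?X * ?X ^ (s - 1)" using Q by simp
      also have "\<dots> = ?X ^ s" using s by (simp flip: power_Suc)
      finally have "real (?X * Q) \<le> real (?X ^ s)" by (simp only: of_nat_le_iff)
      also have "\<dots> = F * real h ^ (n * s)"
        by (simp only: F_def power_mult_distrib power_mult of_nat_mult of_nat_power)
      also have "\<dots> = F * real h powr real (n * s)" by (simp only: power_eq_powr[OF h])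
      finally have "(real ?X * real Q) powr \<delta> \<le> (F * real h powr real (n * s)) powr \<delta>"
        using \<delta> by (intro powr_mono2) auto
      also have "\<dots> = F powr \<delta> * real h powr (real (n * s) * \<delta>)"
        by (simp add: F_def powr_mult powr_powr)
      also have "\<dots> \<le> F powr \<delta> * real h powr (e / 2)"
        using h ns by (intro mult_left_mono powr_mono) auto
      finally have "K * (real ?X * real Q) powr \<delta> \<le> ?a" using K by (simp add: mult.assoc)
      then show "finite {d::int. d \<noteq> 0 \<and> nat \<bar>d\<bar> \<le> ?X \<and> prime_factors (nat \<bar>d\<bar>) \<subseteq> prime_factors Q} \<and>
          real (card {d::int. d \<noteq> 0 \<and> nat \<bar>d\<bar> \<le> ?X \<and> prime_factors (nat \<bar>d\<bar>) \<subseteq> prime_factors Q}) \<le> ?a"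
        using supp[OF Q(1), of ?X] by linarith
    qed (use dets h K C1 in auto)
    also have "\<dots> \<le> real s * ((3 * real h) ^ k * (?a * ?b))"
    proof -
      have "real ((2 * h + 1) ^ k) = (2 * real h + 1) ^ k" by (simp add: add.commute)
      also have "\<dots> \<le> (3 * real h) ^ k" using h by (intro power_mono) auto
      finally show ?thesis using K C1 by (intro mult_left_mono mult_right_mono) auto
    qed
    also have "\<dots> = C * (real h ^ k * (real h powr (e / 2) * real h powr (real n ^ 2 - real n + e / 2)))"
      by (simp add: C_def power_mult_distrib mult_ac)
    also have "\<dots> = C * real h powr (real k + (e / 2 + (real n ^ 2 - real n + e / 2)))"
      by (simp only: power_eq_powr[OF h] powr_add)
    \<comment> \<open>The free matrices contribute n^2 (s - 1), the remaining one n^2 - n.\<close>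
    also have "real k + (e / 2 + (real n ^ 2 - real n + e / 2)) = real s * real n ^ 2 - real n + e"
      using s by (simp add: k_def of_nat_diff power2_eq_square algebra_simps)
    finally show ?thesis .
  qed
  then show ?thesis using C by blast
qed

section \<open>Real bounds and the o(1) in the exponent\<close>

lemma K_tuples_nat_floor:
  assumes "H \<ge> 0"
  shows "K_tuples n s H = K_tuples n s (real (nat \<lfloor>H\<rfloor>))"
proof -
  have "\<bar>real_of_int a\<bar> \<le> H \<longleftrightarrow> \<bar>real_of_int a\<bar> \<le> real (nat \<lfloor>H\<rfloor>)" for a
  proof -
    have "\<bar>real_of_int a\<bar> \<le> H \<longleftrightarrow> \<bar>a\<bar> \<le> \<lfloor>H\<rfloor>" by (simp add: le_floor_iff)
    also have "\<dots> \<longleftrightarrow> real_of_int \<bar>a\<bar> \<le> real_of_int \<lfloor>H\<rfloor>" by (simp only: of_int_le_iff)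
    finally show ?thesis using assms by simp
  qed
  then have "bounded_int_mats n H = bounded_int_mats n (real (nat \<lfloor>H\<rfloor>))"
    unfolding bounded_int_mats_def by blast
  then show ?thesis unfolding K_tuples_def by simp
qed

text \<open>The constant \<open>C\<close> may depend on \<open>e\<close>; on the logarithmic scale
  it disappears in the limit, so one function serves all \<open>e\<close>.\<close>

lemma exponent_little_o:
  fixes f :: "real \<Rightarrow> real"
  assumes f: "\<And>H. f H \<ge> 0"
    and bound: "\<And>e. e > 0 \<Longrightarrow> \<exists>C>0. \<forall>H\<ge>1. f H \<le> C * H powr (a + e)"
  shows "\<exists>\<epsilon>. (\<epsilon> \<longlongrightarrow> 0) at_top \<and> (\<forall>\<^sub>F H in at_top. f H \<le> H powr (a + \<epsilon> H))"
proof -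
  \<comment> \<open>This is the excess of the actual exponent over \<open>a\<close>, cut off at 0
    because \<open>f\<close> may be far below H^a. Where \<open>f\<close> vanishes the logarithm is
    only a default value.\<close>
  define \<epsilon> where "\<epsilon> = (\<lambda>H. if f H = 0 then 0 else max 0 (ln (f H) / ln H - a))"
  have "(\<epsilon> \<longlongrightarrow> 0) at_top"
  proof (rule tendstoI)
    fix e :: real assume e: "e > 0"
    obtain C where C: "C > 0" and fC: "\<And>H. H \<ge> 1 \<Longrightarrow> f H \<le> C * H powr (a + e / 2)"
      using bound[of "e / 2"] e by auto
    \<comment> \<open>From here on the constant satisfies C < H^(e/2).\<close>
    have "eventually (\<lambda>H. ln H > 2 * \<bar>ln C\<bar> / e) at_top"
      using ln_at_top unfolding filterlim_at_top_dense by blast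
    then show "eventually (\<lambda>H. dist (\<epsilon> H) 0 < e) at_top"
      using eventually_gt_at_top[of 1]
    proof eventually_elim
      case (elim H)
      show ?case
      proof (cases "f H = 0")
        case False
        then have pos: "f H > 0" using f[of H] by simp
        have lnH: "ln H > 0" using elim by simp
        have "ln (f H) \<le> ln (C * H powr (a + e / 2))" using pos fC[of H] elim by simp
        also have "\<dots> = ln C + (a + e / 2) * ln H"
          using C elim by (simp add: ln_mult ln_powr)
        finally have "ln (f H) \<le> ln C + (a + e / 2) * ln H" .
        moreover have "ln C < e / 2 * ln H" using elim e by (simp add: field_simps)
        ultimately have "ln (f H) < (a + e) * ln H" by (simp add: algebra_simps)
        then have "ln (f H) / ln H < a + e" using lnH by (simp add: pos_divide_less_eq)
        then show ?thesis using False e by (simp add: \<epsilon>_def dist_real_def)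
      qed (use e in \<open>simp add: \<epsilon>_def\<close>)
    qed
  qed
  moreover have "\<forall>\<^sub>F H in at_top. f H \<le> H powr (a + \<epsilon> H)"
    using eventually_gt_at_top[of 1]
  proof eventually_elim
    case (elim H)
    show ?case
    proof (cases "f H = 0")
      case False
      then have pos: "f H > 0" using f[of H] by simp
      have "f H = H powr (ln (f H) / ln H)"
        using pos elim by (simp add: powr_def)
      also have "\<dots> \<le> H powr (a + \<epsilon> H)"
        using False elim by (intro powr_mono) (auto simp: \<epsilon>_def)
      finally show ?thesis .
    qed simp
  qed
  ultimately show ?thesis by blast
qed

theorem theorem2p8:
  fixes n s :: nat
  assumes "n \<ge> 1" and "s \<ge> 1"
  shows "\<exists>\<epsilon> :: real \<Rightarrow> real. (\<epsilon> \<longlongrightarrow> 0) at_top \<and>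
           (\<forall>\<^sub>F H in at_top. real (card (K_tuples n s H))
              \<le> H powr (real s * real n ^ 2 - real n + \<epsilon> H))"
proof (rule exponent_little_o)
  fix e :: real assume e: "e > 0"
  let ?x = "real s * real n ^ 2 - real n + e"
  \<comment> \<open>The exponent must be nonnegative for the power of the floor of \<open>H\<close>
    to be at most that of \<open>H\<close>.\<close>
  have "n * 1 \<le> n * (n * s)" using assms by (intro mult_le_mono2) auto
  then have "real n \<le> real (n * (n * s))" by (simp only: of_nat_le_iff mult_1_right)
  then have x: "?x \<ge> 0" using e by (simp add: power2_eq_square mult_ac)
  obtain C where C: "C > 0" and K: "\<And>h. h \<ge> 1 \<Longrightarrow> real (card (K_tuples n s (real h))) \<le> C * real h powr ?x"
    using card_K_tuples_bound[OF e assms(2), of n] by blast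
  have "real (card (K_tuples n s H)) \<le> C * H powr ?x" if "H \<ge> 1" for H
  proof -
    \<comment> \<open>Entries are integers, so \<open>H\<close> and its floor give the same
      tuples.\<close>
    have "real (card (K_tuples n s H)) \<le> C * real (nat \<lfloor>H\<rfloor>) powr ?x"
      using K[of "nat \<lfloor>H\<rfloor>"] K_tuples_nat_floor[of H n s] that by (simp add: le_nat_floor)
    also have "\<dots> \<le> C * H powr ?x"
      using x C that by (intro mult_left_mono powr_mono2) auto
    finally show ?thesis .
  qed
  then show "\<exists>C>0. \<forall>H\<ge>1. real (card (K_tuples n s H)) \<le> C * H powr ?x" using C by blast
qed simp

end
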